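(* For $p\in(0,1]$ and $M>0$ let $v^{\mathrm{que}}_{p,M}$ be the quenched asymptotic speed of the killed random walk on $\mathbb{Z}$ in the i.i.d. Bernoulli potential taking value $M$ with probability $p$ and $0$ with probability $1-p$. Then: (i) for every $M_0>0$, $\;v^{\mathrm{que}}_{p,M}\sim \dfrac{3p}{2}$ as $p\to 0$, uniformly in $M\in[M_0,\infty)$; (ii) $\;v^{\mathrm{que}}_{p,M}\sim \dfrac{3p}{2-p+2p^2}$ as $M\to\infty$, locally uniformly in $p\in(0,1]$.
   Context: Potential: for $p\in(0,1]$, $M>0$, let $V(x,\omega)$, $x\in\mathbb{Z}$, be i.i.d. random variables on a probability space $(\Omega,\mathcal{F},\mathbb{P})$ with $\mathbb{P}(V(x,\cdot)=M)=p=1-\mathbb{P}(V(x,\cdot)=0)$. Killed walk: for fixed $\omega$, $P^\omega$ (expectation $E^\omega$) is the law of the Markov chain $(S_n)_{n\ge0}$ on $\mathbb{Z}\cup\{\dagger\}$ started at $0$ which from $x\in\mathbb{Z}$ moves to $\dagger$ with probability $1-e^{-V(x,\omega)}$ and to each of $x\pm1$ with probability $\frac12e^{-V(x,\omega)}$; $\dagger$ is absorbing. Set $\tau_x=\inf\{n>0: S_n=x\}\in\mathbb{N}\cup\{\infty\}$. Quenched path measure: for $y\in\mathbb{N}$, $Q^\omega_y(\cdot)=P^\omega(\,\cdot\mid\tau_y<\infty)$, with expectation $E_{Q^\omega_y}$. Quenched speed: $v^{\mathrm{que}}_{p,M}$ is the deterministic quantity defined by $\dfrac{1}{v^{\mathrm{que}}_{p,M}}=\lim_{y\to\infty}\dfrac{E_{Q^\omega_y}(\tau_y)}{y}$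 ($\mathbb{P}$-a.s.); this limit exists, is finite and non-random. Notation: $f\sim g$ means $f/g\to1$; "uniformly" means that the convergence of the ratio to $1$ is uniform in the indicated parameter, and "locally uniformly in $p\in(0,1]$" means uniformly on compact subsets of $(0,1]$. *)

theory Defs
  imports "HOL-Probability.Probability"
begin

locale bernoulli_potential = prob_space P for P :: "'w measure" +
  fixes V :: "int \<Rightarrow> 'w \<Rightarrow> real" and p M :: real
  assumes indep: "indep_vars (\<lambda>_. borel) V UNIV"
    and prob_M: "prob {\<omega> \<in> space P. V x \<omega> = M} = p"
    and prob_0: "prob {\<omega> \<in> space P. V x \<omega> = 0} = 1 - p"

text \<open>
  The walk in a fixed environment \<open>U\<close> has state space \<open>int option\<close>, where \<^term>\<open>None\<close> is
  the cemetery. As \<^const>\<open>bernoulli_pmf\<close> truncates its parameter to the unit interval, the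
  step is defined for every \<open>U\<close>; it has the intended meaning for \<open>U \<ge> 0\<close>.
\<close>

definition walk_step :: "(int \<Rightarrow> real) \<Rightarrow> int option \<Rightarrow> int option pmf" where
  "walk_step U s = (case s of
      None \<Rightarrow> return_pmf None
    | Some x \<Rightarrow> bind_pmf (bernoulli_pmf (exp (- U x))) (\<lambda>survives.
        if survives then pmf_of_set {Some (x - 1), Some (x + 1)} else return_pmf None))"

lemma pmf_walk_step_Some:
  assumes "0 \<le> U x"
  shows "pmf (walk_step U (Some x)) None = 1 - exp (- U x)"
    and "pmf (walk_step U (Some x)) (Some z) =
      (if z = x - 1 \<or> z = x + 1 then exp (- U x) / 2 else 0)"
  using assms by (auto simp: walk_step_def pmf_bind indicator_def)

lemma pmf_walk_step_None: "pmf (walk_step U None) s = (if s = None then 1 else 0)"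
  by (cases s) (auto simp: walk_step_def indicator_def)

definition walk_kernel ::
  "(int \<Rightarrow> real) \<Rightarrow> nat \<Rightarrow> (nat \<Rightarrow> int option) \<Rightarrow> int option measure" where
  "walk_kernel U n S =
    measure_pmf (if n = 0 then return_pmf (Some 0) else walk_step U (S (n - 1)))"

interpretation walk: Ionescu_Tulcea "walk_kernel U" "\<lambda>_. count_space UNIV" for U
proof (rule Ionescu_Tulcea.intro)
  fix n
  show "walk_kernel U n \<in> measurable (PiM {0..<n} (\<lambda>_. count_space UNIV))
      (subprob_algebra (count_space UNIV))"
  proof (cases n)
    case 0
    then show ?thesis
      by (auto simp: walk_kernel_def[abs_def] space_subprob_algebra
          intro!: measurable_const prob_space_imp_subprob_space measure_pmf.prob_space_axioms)
  next
    case (Suc m)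
    have "(\<lambda>S. S m) \<in> measurable (PiM {0..<n} (\<lambda>_. count_space UNIV :: int option measure))
        (count_space UNIV)"
      using Suc by (intro measurable_component_singleton) auto
    moreover have "(\<lambda>s. measure_pmf (walk_step U s)) \<in>
        measurable (count_space UNIV) (subprob_algebra (count_space UNIV))"
      by (auto simp: space_subprob_algebra
          intro!: prob_space_imp_subprob_space measure_pmf.prob_space_axioms)
    ultimately have "(\<lambda>S. measure_pmf (walk_step U (S m))) \<in>
        measurable (PiM {0..<n} (\<lambda>_. count_space UNIV)) (subprob_algebra (count_space UNIV))"
      by (rule measurable_compose)
    then show ?thesis
      using Suc by (simp add: walk_kernel_def[abs_def])
  qed
next
  fix n and S :: "nat \<Rightarrow> int option"
  show "prob_space (walk_kernel U n S)"
    by (simp add: walk_kernel_def measure_pmf.prob_space_axioms)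
qed

definition killed_walk :: "(int \<Rightarrow> real) \<Rightarrow> (nat \<Rightarrow> int option) measure" where
  "killed_walk U = walk.PF.lim U"

lemma sets_killed_walk: "sets (killed_walk U) = sets (PiM UNIV (\<lambda>_. count_space UNIV))"
  by (simp add: killed_walk_def walk.PF.sets_lim)

lemma space_killed_walk: "space (killed_walk U) = UNIV"
  by (simp add: sets_eq_imp_space_eq[OF sets_killed_walk] space_PiM)

lemma emeasure_walk_C:
  "emeasure (walk.C U 0 (Suc n) (\<lambda>_. undefined)) {restrict x {0..<Suc n}} =
    ennreal ((if x 0 = Some 0 then 1 else 0) * (\<Prod>i<n. pmf (walk_step U (x i)) (x (Suc i))))"
proof -
  let ?K = "\<lambda>_. count_space UNIV :: int option measure"
  have sets: "{restrict x {0..<m}} \<in> sets (PiM {0..<m} ?K)" for m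
  proof -
    have "{restrict x {0..<m}} = PiE {0..<m} (\<lambda>i. {x i})"
      by (auto simp: PiE_iff fun_eq_iff extensional_def)
    then show ?thesis by (simp add: sets_PiM_I_finite)
  qed
  have step: "emeasure (walk.C U 0 (Suc m) (\<lambda>_. undefined)) {restrict x {0..<Suc m}} =
      emeasure (walk.C U 0 m (\<lambda>_. undefined)) {restrict x {0..<m}} *
      emeasure (walk_kernel U m (restrict x {0..<m})) {x m}" for m
  proof -
    have u: "(\<lambda>_. undefined) \<in> space (PiM {0..<0::nat} ?K)"
      by (simp add: space_PiM)
    have spC: "space (walk.C U 0 m (\<lambda>_. undefined)) = space (PiM {0..<m} ?K)"
      using walk.space_C[OF u, of U m] by simp
    have setsC: "sets (walk.C U 0 m (\<lambda>_. undefined)) = sets (PiM {0..<m} ?K)"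
      using walk.sets_C[OF u, of U m] by simp
    have eP: "walk.eP U m \<in> measurable (walk.C U 0 m (\<lambda>_. undefined)) (subprob_algebra (PiM {0..<Suc m} ?K))"
      using walk.measurable_eP measurable_cong_sets[OF setsC refl] by blast
    have "emeasure (walk.C U 0 (Suc m) (\<lambda>_. undefined)) {restrict x {0..<Suc m}} =
        (\<integral>\<^sup>+ S. emeasure (walk.eP U m S) {restrict x {0..<Suc m}} \<partial>walk.C U 0 m (\<lambda>_. undefined))"
      by (simp add: emeasure_bind[OF _ eP sets] spC space_PiM_empty_iff)
    also have "\<dots> = (\<integral>\<^sup>+ S. emeasure (walk_kernel U m (restrict x {0..<m})) {x m} *
        indicator {restrict x {0..<m}} S \<partial>walk.C U 0 m (\<lambda>_. undefined))"
    proof (rule nn_integral_cong)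
      fix S assume "S \<in> space (walk.C U 0 m (\<lambda>_. undefined))"
      then have S: "S \<in> space (PiM {0..<m} ?K)" by (simp add: spC)
      then have ext: "S \<in> extensional {0..<m}" by (simp add: space_PiM PiE_iff)
      have "(\<lambda>s. S(m := s)) -` {restrict x {0..<Suc m}} \<inter> space (?K m) =
          (if S = restrict x {0..<m} then {x m} else {})"
        using ext by (auto simp: fun_eq_iff extensional_def restrict_def less_Suc_eq)
          (metis (full_types) less_irrefl less_Suc_eq)+
      then show "emeasure (walk.eP U m S) {restrict x {0..<Suc m}} =
          emeasure (walk_kernel U m (restrict x {0..<m})) {x m} * indicator {restrict x {0..<m}} S"
        by (simp add: walk.emeasure_eP[OF S sets])
    qed
    also have "\<dots> = emeasure (walk_kernel U m (restrict x {0..<m})) {x m} *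
        emeasure (walk.C U 0 m (\<lambda>_. undefined)) {restrict x {0..<m}}"
      by (rule nn_integral_cmult_indicator) (use sets setsC in blast)
    finally show ?thesis by (simp add: mult.commute)
  qed
  show ?thesis
  proof (induction n)
    case 0
    have "emeasure (walk.C U 0 0 (\<lambda>_. undefined)) {restrict x {0..<0}} = 1"
      by (simp add: PiM_empty restrict_def)
    then show ?case
      by (simp only: step) (simp add: walk_kernel_def emeasure_pmf_single indicator_def)
  next
    case (Suc n)
    show ?case
      by (subst step, subst Suc)
        (simp add: walk_kernel_def emeasure_pmf_single ennreal_mult prod_nonneg)
  qed
qed

text \<open>The coordinate process under \<open>killed_walk U\<close> is the Markov chain started at the origin.\<close>

lemma emeasure_killed_walk:
  "emeasure (killed_walk U) {S. \<forall>i\<le>n. S i = x i} =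
    ennreal ((if x 0 = Some 0 then 1 else 0) * (\<Prod>i<n. pmf (walk_step U (x i)) (x (Suc i))))"
proof -
  let ?K = "\<lambda>_. count_space UNIV :: int option measure" and ?J = "{0..<Suc n}"
  let ?X = "{restrict x ?J}"
  have "?X = PiE ?J (\<lambda>i. {x i})"
    by (auto simp: PiE_iff fun_eq_iff extensional_def)
  then have X: "?X \<in> sets (PiM ?J ?K)" by (simp add: sets_PiM_I_finite)
  have "prod_emb UNIV ?K ?J ?X = {S. \<forall>i\<le>n. S i = x i}"
    by (auto simp: prod_emb_def space_PiM fun_eq_iff restrict_def less_Suc_eq_le) metis
  moreover have "prod_emb ?J ?K ?J ?X = ?X"
    by (rule prod_emb_id) (auto simp: PiE_iff)
  ultimately show ?thesis
    using walk.lim[OF _ X, of U] walk.emeasure_CI[OF subset_refl X, of U] emeasure_walk_C[of U n x]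
    by (simp add: killed_walk_def)
qed

definition hitting_time :: "int \<Rightarrow> (nat \<Rightarrow> int option) \<Rightarrow> enat" where
  "hitting_time x S = (INF n \<in> {n. 0 < n \<and> S n = Some x}. enat n)"

definition quenched_path_measure ::
  "(int \<Rightarrow> real) \<Rightarrow> nat \<Rightarrow> (nat \<Rightarrow> int option) measure" where
  "quenched_path_measure U y = uniform_measure (killed_walk U)
    {S \<in> space (killed_walk U). hitting_time (int y) S < \<infinity>}"

definition quenched_mean_time :: "(int \<Rightarrow> real) \<Rightarrow> nat \<Rightarrow> ennreal" where
  "quenched_mean_time U y =
    (\<integral>\<^sup>+ S. ennreal_of_enat (hitting_time (int y) S) \<partial>quenched_path_measure U y)"

text \<open>
  The deterministic limit of \<open>E(\<tau>\<^sub>y) / y\<close> is required to be the reciprocal of a positive real.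
\<close>

definition quenched_speed :: "'w measure \<Rightarrow> (int \<Rightarrow> 'w \<Rightarrow> real) \<Rightarrow> real" where
  "quenched_speed P V = (THE v. 0 < v \<and>
    (AE \<omega> in P. (\<lambda>y. quenched_mean_time (\<lambda>x. V x \<omega>) y / of_nat y) \<longlonglongrightarrow> ennreal (1 / v)))"

end

theory Submission
  imports
    Defs
    "HOL-Computational_Algebra.Formal_Power_Series"
    "HOL-Library.Discrete_Functions"
begin

text \<open>
  Write \<open>a\<^sub>x = exp (- V x)\<close>. On its way from \<open>0\<close> to \<open>y\<close> the walk passes from \<open>x\<close> to \<open>x + 1\<close>
  for the first time for \<open>x = 0, 1, ..., y - 1\<close>, and a passage from \<open>x\<close> to \<open>x + 1\<close> either goes up
  at once or goes down and then has to pass from \<open>x - 1\<close> to \<open>x\<close> and from \<open>x\<close> to \<open>x + 1\<close>. So the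
  generating function \<open>H\<^sub>x\<close> of the (defective) law of this passage time satisfies
  \<open>H\<^sub>x(z) = a\<^sub>x/2 z (1 + H\<^sub>x\<^sub>-\<^sub>1(z) H\<^sub>x(z))\<close>, and the hitting time of \<open>y\<close> has the generating function
  \<open>H\<^sub>0 H\<^sub>1 ... H\<^sub>y\<^sub>-\<^sub>1\<close>. The mean of \<open>\<tau>\<^sub>y\<close> given \<open>\<tau>\<^sub>y < \<infinity>\<close> is the logarithmic derivative of
  this product at \<open>1\<close> and therefore a sum of terms \<open>t\<^sub>x\<close>, \<open>0 \<le> x < y\<close>; with \<open>g\<^sub>x = H\<^sub>x(1)\<close> the
  functional equation becomes
  \<open>g\<^sub>x = a\<^sub>x / (2 - a\<^sub>x g\<^sub>x\<^sub>-\<^sub>1)\<close> and \<open>t\<^sub>x = 1 + g\<^sub>x g\<^sub>x\<^sub>-\<^sub>1 (1 + t\<^sub>x\<^sub>-\<^sub>1)\<close>.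
  The relevant solution is the minimal one, the increasing limit of the values obtained by putting a
  wall \<open>g = t = 0\<close> further and further to the left (\<open>quenched_mean_time_eq\<close>).

  Thus \<open>t\<^sub>x\<close> is a stationary functional of an i.i.d. environment, and its averages converge almost
  surely to \<open>T = E t\<^sub>0\<close> as soon as \<open>T\<close> is finite (\<open>AE_average_passage_time\<close>). The version with a wall
  at a fixed distance depends on finitely many sites, so a variance bound along the squares is enough
  for it; the maximal ergodic inequality carries the convergence over to the limit. Hence the speed is
  \<open>1 / T\<close>, and everything rests on estimating \<open>T\<close>.

  Let \<open>K\<close> be the distance from \<open>0\<close> to the nearest obstacle weakly to its left, which is geometric
  with parameter \<open>p\<close>. Along a gap the recursion is solved by \<open>g = 1 - 1 / (K + c)\<close>, where
  \<open>c = 1 / (1 - g)\<close> at the obstacle. For an impenetrable obstacle \<open>c = 1\<close>, and then \<open>t = 1\<close> at \<open>K = 0\<close>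
  and \<open>t = (2 K + 1) / 3\<close> at \<open>K \<ge> 1\<close>. The mean of this is
  \<open>L = (2 - p + 2 p\<^sup>2) / (3 p)\<close>, and \<open>L \<le> T\<close> because the recursion is monotone. For an obstacle of
  finite height \<open>1 \<le> c \<le> 1 + \<delta>\<close> with \<open>\<delta> = e\<^sup>-\<^sup>M / (2 - 2 e\<^sup>-\<^sup>M)\<close>, and comparison with the explicit
  solution for \<open>c = 1 + \<delta>\<close> gives \<open>T \<le> L + 3 \<delta> + p \<delta> T\<close>. Therefore, when \<open>p \<delta> < 1\<close>,
  \<open>L \<le> T \<le> (L + 3 \<delta>) / (1 - p \<delta>)\<close> (\<open>mean_window_time_ge\<close>, \<open>mean_window_time_le\<close>). As \<open>p \<rightarrow> 0\<close> with
  \<open>M \<ge> M\<^sub>0\<close> the number \<open>\<delta>\<close> stays bounded while \<open>p L \<rightarrow> 2/3\<close>; as \<open>M \<rightarrow> \<infinity>\<close> we have \<open>\<delta> \<rightarrow> 0\<close> while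
  \<open>L \<ge> 1\<close> for every \<open>p\<close>. Both asymptotic formulas follow.
\<close>


section \<open>The leftward recursion for one step up\<close>

text \<open>
  A list holds the survival probabilities of a site and of its neighbours to the left, nearest first,
  and the walk is killed when it steps beyond the end of the list. Then \<open>up_prob\<close> is the probability of
  ever stepping above the first site, and \<open>up_time\<close> is the mean time that this takes, conditioned on
  success.
\<close>

fun up_prob :: "real list \<Rightarrow> real" where
  "up_prob [] = 0"
| "up_prob (a # as) = a / (2 - a * up_prob as)"

fun up_time :: "real list \<Rightarrow> real" where
  "up_time [] = 0"
| "up_time (a # as) = 1 + up_prob (a # as) * up_prob as * (1 + up_time as)"

lemma up_prob_bounds:
  assumes "set as \<subseteq> {0..1}"
  shows "0 \<le> up_prob as" "up_prob as < 1"
proof -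
  have "0 \<le> up_prob as \<and> up_prob as < 1"
    using assms
  proof (induction as)
    case (Cons a as)
    then have IH: "0 \<le> up_prob as" "up_prob as < 1" and a: "0 \<le> a" "a \<le> 1" by auto
    have "a * up_prob as \<le> 1 * up_prob as" using a IH by (intro mult_right_mono) auto
    then have "a * up_prob as < 1" using IH by simp
    then show ?case using a by (auto simp: divide_simps)
  qed simp
  then show "0 \<le> up_prob as" "up_prob as < 1" by auto
qed

text \<open>
  Monotonicity of one step of the recursion is the source of all comparisons below: removing killing
  or moving the wall away can only increase \<open>up_prob\<close> and \<open>up_time\<close>.
\<close>

lemma up_step_mono:
  fixes a e f :: real
  assumes "0 \<le> a" "a \<le> 1" "e \<le> f" "f \<le> 1"
  shows "a / (2 - a * e) \<le> a / (2 - a * f)"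
proof -
  have "a * e \<le> a * f" using assms by (intro mult_left_mono) auto
  moreover have "a * f \<le> 1" using mult_left_mono[of f 1 a] assms by linarith
  ultimately show ?thesis using assms by (intro divide_left_mono mult_pos_pos) auto
qed

lemma up_prob_append_mono:
  assumes "set as \<subseteq> {0..1}" "set bs \<subseteq> {0..1}"
  shows "up_prob as \<le> up_prob (as @ bs)"
  using assms(1)
proof (induction as)
  case Nil
  then show ?case using up_prob_bounds[OF assms(2)] by simp
next
  case (Cons a as)
  then show ?case using up_prob_bounds[of "as @ bs"] assms(2)
    by (auto intro!: up_step_mono)
qed

lemma up_time_nonneg:
  assumes "set as \<subseteq> {0..1}"
  shows "0 \<le> up_time as"
  using assms
proof (induction as)
  case (Cons a as)
  then show ?case using up_prob_bounds[of as] up_prob_bounds[of "a # as"]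
    by (auto intro!: add_nonneg_nonneg mult_nonneg_nonneg simp del: up_prob.simps(2))
qed simp

lemma up_time_append_mono:
  assumes "set as \<subseteq> {0..1}" "set bs \<subseteq> {0..1}"
  shows "up_time as \<le> up_time (as @ bs)"
  using assms(1)
proof (induction as)
  case Nil
  then show ?case using up_time_nonneg[OF assms(2)] by simp
next
  case (Cons a as)
  have "up_prob (a # as) * up_prob as * (1 + up_time as) \<le>
      up_prob (a # (as @ bs)) * up_prob (as @ bs) * (1 + up_time (as @ bs))"
    using Cons assms(2) up_prob_append_mono[of "a # as" bs] up_prob_append_mono[of as bs]
      up_prob_bounds[of as] up_prob_bounds[of "a # (as @ bs)"] up_prob_bounds[of "as @ bs"]
      up_time_nonneg[of as]
    by (intro mult_mono mult_nonneg_nonneg) (auto simp del: up_prob.simps(2))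
  then show ?case by (simp del: up_prob.simps(2))
qed

definition left_window :: "(int \<Rightarrow> 'a) \<Rightarrow> nat \<Rightarrow> int \<Rightarrow> 'a list" where
  "left_window f m x = map (\<lambda>i. f (x - int i)) [0..<m]"

lemma left_window_0 [simp]: "left_window f 0 x = []"
  by (simp add: left_window_def)

lemma left_window_Suc: "left_window f (Suc m) x = f x # left_window f m (x - 1)"
  unfolding left_window_def by (subst upt_conv_Cons) (auto simp: map_Suc_upt[symmetric] algebra_simps simp del: upt_Suc)

lemma length_left_window [simp]: "length (left_window f m x) = m"
  by (simp add: left_window_def)

lemma left_window_append:
  "left_window f (m + n) x = left_window f m x @ left_window f n (x - int m)"
  by (induction m arbitrary: x) (auto simp: left_window_Suc algebra_simps)

lemma set_left_window: "set (left_window f m x) \<subseteq> range f"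
  by (auto simp: left_window_def)

lemma map_left_window: "map g (left_window f m x) = left_window (\<lambda>i. g (f i)) m x"
  by (simp add: left_window_def)

section \<open>Generating functions\<close>

unbundle no vec_syntax and fps_syntax

text \<open>
  For series with nonnegative coefficients, convergence at \<open>1\<close> is compatible with all the operations
  needed, so the probabilistic generating functions can be handled as formal power series.
\<close>

definition fps_sums :: "real fps \<Rightarrow> real \<Rightarrow> bool" where
  "fps_sums A s \<longleftrightarrow> (\<forall>n. 0 \<le> A $ n) \<and> (\<lambda>n. A $ n) sums s"

lemma fps_sums_unique: "fps_sums A s \<Longrightarrow> fps_sums A t \<Longrightarrow> s = t"
  by (auto simp: fps_sums_def intro: sums_unique2)

lemma fps_sums_1: "fps_sums 1 1"
  using sums_single[of 0 "\<lambda>_. 1 :: real"] by (auto simp: fps_sums_def fps_one_nth)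

lemma fps_sums_X: "fps_sums fps_X 1"
  using sums_single[of 1 "\<lambda>_. 1 :: real"] by (auto simp: fps_sums_def fps_X_nth)

lemma fps_sums_const: "0 \<le> c \<Longrightarrow> fps_sums (fps_const c) c"
  using sums_single[of 0 "\<lambda>_. c"] by (auto simp: fps_sums_def if_distrib cong: if_cong)

lemma fps_sums_add: "fps_sums A s \<Longrightarrow> fps_sums B t \<Longrightarrow> fps_sums (A + B) (s + t)"
  by (auto simp: fps_sums_def intro: sums_add)

lemma fps_sums_mult:
  assumes "fps_sums A s" "fps_sums B t"
  shows "fps_sums (A * B) (s * t)"
proof -
  have n: "summable (\<lambda>n. norm (A $ n))" "summable (\<lambda>n. norm (B $ n))"
    using assms by (auto simp: fps_sums_def intro: sums_summable)
  have "(\<lambda>n. (A * B) $ n) sums (s * t)"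
    using Cauchy_product_sums[OF n] assms
    by (auto simp: fps_sums_def fps_mult_nth atLeast0AtMost sums_iff)
  then show ?thesis using assms by (auto simp: fps_sums_def fps_mult_nth intro!: sum_nonneg)
qed

lemma fps_sums_nonneg: "fps_sums A s \<Longrightarrow> 0 \<le> s"
  by (auto simp: fps_sums_def sums_iff intro: suminf_nonneg)

text \<open>
  Logarithmic differentiation: writing the derivative of each factor at \<open>1\<close> as \<open>s j * t j\<close>, the numbers
  \<open>t j\<close> add up.
\<close>

lemma fps_sums_prod:
  assumes "finite J" "\<And>j. j \<in> J \<Longrightarrow> fps_sums (A j) (s j)"
    "\<And>j. j \<in> J \<Longrightarrow> fps_sums (fps_deriv (A j)) (s j * t j)"
  shows "fps_sums (\<Prod>j\<in>J. A j) (\<Prod>j\<in>J. s j) \<and>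
    fps_sums (fps_deriv (\<Prod>j\<in>J. A j)) ((\<Prod>j\<in>J. s j) * (\<Sum>j\<in>J. t j))"
  using assms
proof (induction J rule: finite_induct)
  case empty
  then show ?case using fps_sums_1 fps_sums_const[of 0] by simp
next
  case (insert k J)
  let ?P = "\<Prod>j\<in>J. A j" and ?s = "\<Prod>j\<in>J. s j" and ?t = "\<Sum>j\<in>J. t j"
  have IH: "fps_sums ?P ?s" "fps_sums (fps_deriv ?P) (?s * ?t)"
    and k: "fps_sums (A k) (s k)" "fps_sums (fps_deriv (A k)) (s k * t k)"
    using insert by auto
  have "fps_sums (A k * fps_deriv ?P + fps_deriv (A k) * ?P)
      (s k * (?s * ?t) + s k * t k * ?s)"
    by (intro fps_sums_add fps_sums_mult IH k)
  moreover have "fps_sums (A k * ?P) (s k * ?s)" by (intro fps_sums_mult IH k)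
  ultimately show ?case using insert.hyps by (simp add: algebra_simps)
qed

lemma sum_convolution_le:
  fixes u v :: "nat \<Rightarrow> real"
  assumes "\<And>n. 0 \<le> u n" "\<And>n. 0 \<le> v n"
  shows "(\<Sum>n\<le>K. \<Sum>i\<le>n. u i * v (n - i)) \<le> (\<Sum>n\<le>K. u n) * (\<Sum>n\<le>K. v n)"
proof -
  have "(\<Sum>n\<le>K. \<Sum>i\<le>n. u i * v (n - i)) = (\<Sum>(i,j)\<in>{(i,j). i + j \<le> K}. u i * v j)"
    by (rule sum.triangle_reindex_eq[symmetric])
  also have "\<dots> \<le> (\<Sum>(i,j)\<in>{..K} \<times> {..K}. u i * v j)"
    using assms by (intro sum_mono2) auto
  finally show ?thesis by (simp add: sum_product sum.cartesian_product)
qed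

context
  fixes a :: "int \<Rightarrow> real"
begin

text \<open>
  \<open>up_coeff x n\<close> is the probability that the walk started at \<open>x\<close> first reaches \<open>x + 1\<close> at time \<open>n\<close>,
  decomposed according to the first step and the time of the return to \<open>x\<close>.
\<close>

fun up_coeff :: "int \<Rightarrow> nat \<Rightarrow> real" where
  "up_coeff x 0 = 0"
| "up_coeff x (Suc n) =
    a x / 2 * ((if n = 0 then 1 else 0) + (\<Sum>i\<le>n. up_coeff (x - 1) i * up_coeff x (n - i)))"

definition up_fps :: "int \<Rightarrow> real fps" where
  "up_fps x = Abs_fps (up_coeff x)"

text \<open>
  \<open>hit_coeff y n x\<close> is the probability that the walk started at \<open>x\<close> first visits \<open>y\<close> at time \<open>n\<close>, where
  the visit at time \<open>0\<close> counts.
\<close>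

fun hit_coeff :: "int \<Rightarrow> nat \<Rightarrow> int \<Rightarrow> real" where
  "hit_coeff y 0 x = (if x = y then 1 else 0)"
| "hit_coeff y (Suc n) x =
    (if x = y then 0 else a x / 2 * (hit_coeff y n (x - 1) + hit_coeff y n (x + 1)))"

lemma up_fps_eq:
  "up_fps x = fps_const (a x / 2) * (fps_X * (1 + up_fps (x - 1) * up_fps x))"
proof (rule fps_ext)
  fix n
  show "up_fps x $ n = (fps_const (a x / 2) * (fps_X * (1 + up_fps (x - 1) * up_fps x))) $ n"
    by (cases n) (simp_all add: up_fps_def fps_mult_nth[of "Abs_fps _"] atLeast0AtMost fps_one_nth)
qed

text \<open>
  The first passage decomposition. By the functional equation of \<open>up_fps\<close>, the product solves the same
  linear system in \<open>x\<close> as the generating function of the hitting time. Each coefficient of a solution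
  is determined by the preceding coefficients, so the two agree.
\<close>

lemma hit_coeff_eq_prod:
  assumes "x \<le> y"
  shows "hit_coeff y n x = (\<Prod>j\<in>{x..<y}. up_fps j) $ n"
  using assms
proof (induction n arbitrary: x)
  case 0
  show ?case
  proof (cases "x = y")
    case False
    then have "x \<in> {x..<y}" using 0 by auto
    moreover have "up_fps x $ 0 = 0" by (simp add: up_fps_def)
    ultimately have "(\<Prod>j\<in>{x..<y}. up_fps j) $ 0 = 0"
      by (subst prod.remove[of _ x]) auto
    then show ?thesis using False by simp
  qed simp
next
  case (Suc n)
  show ?case
  proof (cases "x = y")
    case False
    define D where "D z = (\<Prod>j\<in>{z..<y}. up_fps j)" for z
    have D_rec: "D z = up_fps z * D (z + 1)" if "z < y" for z
    proof -
      have "{z..<y} = insert z {z+1..<y}" using that by auto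
      then show ?thesis by (simp add: D_def)
    qed
    have "x < y" using False Suc.prems by simp
    have "D x = fps_const (a x / 2) * (fps_X * (1 + up_fps (x - 1) * up_fps x)) * D (x + 1)"
      using D_rec[OF \<open>x < y\<close>] up_fps_eq[of x] by metis
    also have "\<dots> = fps_const (a x / 2) * (fps_X * (D (x + 1) + D (x - 1)))"
      using D_rec[OF \<open>x < y\<close>] D_rec[of "x - 1"] \<open>x < y\<close> by (simp add: algebra_simps)
    finally have "D x $ Suc n = a x / 2 * (D (x + 1) $ n + D (x - 1) $ n)" by simp
    then show ?thesis using Suc.IH[of "x - 1"] Suc.IH[of "x + 1"] \<open>x < y\<close> by (simp add: D_def)
  qed simp
qed

context
  assumes a01: "\<And>x. 0 < a x" "\<And>x. a x \<le> 1"
begin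

lemma left_window_unit: "set (left_window a m x) \<subseteq> {0..1}"
  using set_left_window[of a m x] a01 by (force simp: less_imp_le)

lemma up_coeff_nonneg: "0 \<le> up_coeff x n"
proof (induction n arbitrary: x rule: less_induct)
  case (less n)
  then show ?case using a01(1)[of x]
    by (cases n) (auto intro!: mult_nonneg_nonneg add_nonneg_nonneg sum_nonneg)
qed

text \<open>
  In \<open>K\<close> steps the walk sees at most \<open>K\<close> sites. Together with \<open>up_prob_le_up_total\<close> this identifies
  the passage probability as the limit of the values with a wall, which is the minimal one among
  the solutions of the recursion.
\<close>

lemma up_coeff_partial_sum_le: "(\<Sum>n\<le>K. up_coeff x n) \<le> up_prob (left_window a K x)"
proof (induction K arbitrary: x)
  case (Suc K)
  define S where "S = (\<Sum>n\<le>Suc K. up_coeff x n)"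
  define e where "e = up_prob (left_window a K (x - 1))"
  have e: "0 \<le> e" "e < 1" using up_prob_bounds[OF left_window_unit] by (auto simp: e_def)
  have "S = (\<Sum>n\<le>K. up_coeff x (Suc n))"
    unfolding S_def by (subst sum.atMost_Suc_shift) simp
  also have "\<dots> = a x / 2 * (1 + (\<Sum>n\<le>K. \<Sum>i\<le>n. up_coeff (x - 1) i * up_coeff x (n - i)))"
    by (simp only: up_coeff.simps sum_distrib_left[symmetric] sum.distrib) simp
  also have "\<dots> \<le> a x / 2 * (1 + (\<Sum>n\<le>K. up_coeff (x - 1) n) * (\<Sum>n\<le>K. up_coeff x n))"
    using a01(1)[of x] by (intro mult_left_mono add_left_mono sum_convolution_le up_coeff_nonneg) auto
  also have "\<dots> \<le> a x / 2 * (1 + e * S)"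
    using a01(1)[of x] Suc[of "x - 1"] e
    by (intro mult_left_mono add_left_mono mult_mono) (auto simp: S_def e_def up_coeff_nonneg simp del: up_coeff.simps intro!: sum_nonneg add_nonneg_nonneg)
  finally have "S * (2 - a x * e) \<le> a x" by (simp add: algebra_simps)
  moreover have "a x * e < 2"
    using mult_mono[of "a x" 1 e 1] a01[of x] e by linarith
  ultimately show ?case
    by (simp add: left_window_Suc S_def[symmetric] e_def[symmetric] pos_le_divide_eq del: sum.atMost_Suc)
qed simp

definition up_total :: "int \<Rightarrow> real" where
  "up_total x = (\<Sum>n. up_coeff x n)"

lemma up_fps_sums: "fps_sums (up_fps x) (up_total x)"
proof -
  have "summable (up_coeff x)"
  proof (rule bounded_imp_summable)
    show "(\<Sum>n\<le>K. up_coeff x n) \<le> 1" for K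
      using up_coeff_partial_sum_le[of x K] up_prob_bounds[OF left_window_unit[of K x]] by linarith
  qed (rule up_coeff_nonneg)
  then show ?thesis by (simp add: fps_sums_def up_fps_def up_total_def up_coeff_nonneg summable_sums)
qed

lemma up_total_eq: "up_total x = a x / 2 * (1 + up_total (x - 1) * up_total x)"
proof -
  have "fps_sums (fps_const (a x / 2) * (fps_X * (1 + up_fps (x - 1) * up_fps x)))
      (a x / 2 * (1 * (1 + up_total (x - 1) * up_total x)))"
    using a01(1)[of x] by (intro fps_sums_mult fps_sums_add fps_sums_1 fps_sums_X fps_sums_const up_fps_sums) auto
  then show ?thesis
    unfolding up_fps_eq[symmetric] by (subst fps_sums_unique[OF up_fps_sums]) auto
qed

lemma up_total_bounds: "0 < up_total x" "up_total x \<le> 1"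
proof -
  have nn: "0 \<le> up_total z" for z using fps_sums_nonneg[OF up_fps_sums] .
  show "0 < up_total x"
    by (subst up_total_eq) (intro mult_pos_pos add_pos_nonneg mult_nonneg_nonneg nn, use a01(1)[of x] in auto)
  have "(\<lambda>K. \<Sum>n\<le>K. up_coeff x n) \<longlonglongrightarrow> up_total x"
    using up_fps_sums[of x] by (simp add: fps_sums_def up_fps_def sums_def_le)
  moreover have "(\<Sum>n\<le>K. up_coeff x n) \<le> 1" for K
    using up_coeff_partial_sum_le[of x K] up_prob_bounds[OF left_window_unit[of K x]] by linarith
  ultimately show "up_total x \<le> 1" by (intro LIMSEQ_le_const2) auto
qed

lemma up_prob_le_up_total: "up_prob (left_window a m x) \<le> up_total x"
proof (induction m arbitrary: x)
  case 0
  then show ?case using up_total_bounds(1)[of x] by simp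
next
  case (Suc m)
  have "a x * up_total (x - 1) \<le> 1"
    using mult_mono[of "a x" 1 "up_total (x - 1)" 1] a01[of x] up_total_bounds[of "x - 1"] by simp
  then have "up_total x = a x / (2 - a x * up_total (x - 1))"
    using up_total_eq[of x] by (simp add: field_simps)
  then show ?case
    using up_step_mono[OF _ a01(2)[of x] Suc[of "x - 1"] up_total_bounds(2)] a01(1)[of x]
    by (simp add: left_window_Suc)
qed

lemma up_prob_tendsto: "(\<lambda>m. up_prob (left_window a m x)) \<longlonglongrightarrow> up_total x"
proof (rule tendsto_sandwich)
  show "(\<lambda>K. \<Sum>n\<le>K. up_coeff x n) \<longlonglongrightarrow> up_total x"
    using up_fps_sums[of x] by (simp add: fps_sums_def up_fps_def sums_def_le)
qed (auto intro!: always_eventually up_coeff_partial_sum_le up_prob_le_up_total)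

context
  fixes t :: "int \<Rightarrow> real"
  assumes t_lim: "\<And>x. (\<lambda>m. up_time (left_window a m x)) \<longlonglongrightarrow> t x"
begin

lemma mean_up_time_nonneg: "0 \<le> t x"
  by (rule LIMSEQ_le_const[OF t_lim]) (auto intro!: up_time_nonneg left_window_unit)

lemma mean_up_time_eq: "t x = 1 + up_total x * up_total (x - 1) * (1 + t (x - 1))"
proof (rule LIMSEQ_unique)
  show "(\<lambda>m. up_time (left_window a (Suc m) x)) \<longlonglongrightarrow> t x"
    using t_lim by (rule LIMSEQ_Suc)
  have "(\<lambda>m. 1 + up_prob (left_window a (Suc m) x) * up_prob (left_window a m (x - 1)) *
      (1 + up_time (left_window a m (x - 1))))
      \<longlonglongrightarrow> 1 + up_total x * up_total (x - 1) * (1 + t (x - 1))"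
    by (intro tendsto_intros t_lim up_prob_tendsto LIMSEQ_Suc)
  then show "(\<lambda>m. up_time (left_window a (Suc m) x))
      \<longlonglongrightarrow> 1 + up_total x * up_total (x - 1) * (1 + t (x - 1))"
    by (simp add: left_window_Suc)
qed

text \<open>
  The equation for \<open>t\<close> alone would also allow infinite mean passage times. Truncating the time excludes
  this: the truncated first moments are finite, start at \<open>0\<close> and satisfy the recursion as an
  inequality, so they stay below every finite solution.
\<close>

lemma up_coeff_weighted_partial_sum_le: "(\<Sum>n\<le>K. real n * up_coeff x n) \<le> up_total x * t x"
proof (induction K arbitrary: x)
  case 0
  then show ?case using mean_up_time_nonneg[of x] up_total_bounds[of x] by simp
next
  case (Suc K)
  let ?u = "up_coeff (x - 1)" and ?v = "up_coeff x"
  let ?G = "up_total x" and ?H = "up_total (x - 1)"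
  have ps: "(\<Sum>n\<le>K. up_coeff z n) \<le> up_total z" for z
    using up_coeff_partial_sum_le[of z K] up_prob_le_up_total[of K z] by linarith
  have psn: "0 \<le> (\<Sum>n\<le>K. up_coeff z n)" "0 \<le> (\<Sum>n\<le>K. real n * up_coeff z n)" for z
    by (auto intro!: sum_nonneg mult_nonneg_nonneg up_coeff_nonneg)
  note le = mult_mono[OF _ _ _ psn(1)] mult_mono[OF _ _ _ psn(2)]
  have tn: "0 \<le> ?H * t (x - 1)" "0 \<le> ?H" "0 \<le> ?G"
    using mean_up_time_nonneg up_total_bounds[of x] up_total_bounds[of "x - 1"] by auto
  have "(\<Sum>n\<le>Suc K. real n * ?v n) = (\<Sum>n\<le>K. real (Suc n) * ?v (Suc n))"
    by (subst sum.atMost_Suc_shift) simp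
  also have "\<dots> = (\<Sum>n\<le>K. a x / 2 * ((if n = 0 then 1 else 0) +
      ((\<Sum>i\<le>n. ?u i * ?v (n - i)) + (\<Sum>i\<le>n. (real i * ?u i) * ?v (n - i)) +
      (\<Sum>i\<le>n. ?u i * (real (n - i) * ?v (n - i))))))"
  proof (rule sum.cong[OF refl])
    fix n
    have "real (Suc n) * (\<Sum>i\<le>n. ?u i * ?v (n - i)) =
      (\<Sum>i\<le>n. ?u i * ?v (n - i) + (real i * ?u i) * ?v (n - i) + ?u i * (real (n - i) * ?v (n - i)))"
      unfolding sum_distrib_left by (rule sum.cong[OF refl]) (auto simp: of_nat_diff algebra_simps)
    then show "real (Suc n) * ?v (Suc n) = a x / 2 * ((if n = 0 then 1 else 0) +
      ((\<Sum>i\<le>n. ?u i * ?v (n - i)) + (\<Sum>i\<le>n. (real i * ?u i) * ?v (n - i)) +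
      (\<Sum>i\<le>n. ?u i * (real (n - i) * ?v (n - i)))))"
      by (simp only: sum.distrib up_coeff.simps(2)) (simp add: algebra_simps)
  qed
  also have "\<dots> = a x / 2 * (1 + ((\<Sum>n\<le>K. \<Sum>i\<le>n. ?u i * ?v (n - i)) +
      (\<Sum>n\<le>K. \<Sum>i\<le>n. (real i * ?u i) * ?v (n - i)) +
      (\<Sum>n\<le>K. \<Sum>i\<le>n. ?u i * (real (n - i) * ?v (n - i)))))"
    by (simp only: sum_distrib_left[symmetric] sum.distrib) simp
  also have "\<dots> \<le> a x / 2 * (1 + ((\<Sum>n\<le>K. ?u n) * (\<Sum>n\<le>K. ?v n) +
      (\<Sum>n\<le>K. real n * ?u n) * (\<Sum>n\<le>K. ?v n) + (\<Sum>n\<le>K. ?u n) * (\<Sum>n\<le>K. real n * ?v n)))"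
    using a01(1)[of x]
    by (intro mult_left_mono add_left_mono add_mono sum_convolution_le
        mult_nonneg_nonneg up_coeff_nonneg) auto
  also have "\<dots> \<le> a x / 2 * (1 + (?H * ?G + (?H * t (x - 1)) * ?G + ?H * (?G * t x)))"
    using a01(1)[of x] tn
    by (intro mult_left_mono add_left_mono add_mono mult_mono ps Suc psn) auto
  also have "\<dots> = ?G * t x"
  proof -
    have 1: "?G = a x / 2 * (1 + ?H * ?G)" by (rule up_total_eq)
    have 2: "t x = 1 + ?G * ?H * (1 + t (x - 1))" by (rule mean_up_time_eq)
    have "a x / 2 * (1 + (?H * ?G + (?H * t (x - 1)) * ?G + ?H * (?G * t x)))
      = a x / 2 * ((1 + ?G * ?H * (1 + t (x - 1))) + ?H * ?G * t x)"
      by (simp add: algebra_simps)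
    also have "\<dots> = a x / 2 * (1 + ?H * ?G) * t x"
      unfolding 2[symmetric] by (simp add: algebra_simps)
    finally show ?thesis by (simp only: 1[symmetric])
  qed
  finally show ?case .
qed

text \<open>
  The upper bound is the preceding lemma. Conversely, the normalised first moments solve the recursion
  for \<open>t\<close> and are nonnegative, hence dominate all values with a wall and so their limit.
\<close>

lemma up_fps_deriv_sums: "fps_sums (fps_deriv (up_fps x)) (up_total x * t x)"
proof -
  have ex: "\<exists>N. fps_sums (fps_deriv (up_fps z)) N \<and> N \<le> up_total z * t z" for z
  proof -
    let ?f = "\<lambda>n. real n * up_coeff z n"
    have s: "summable ?f"
      by (rule bounded_imp_summable[OF _ up_coeff_weighted_partial_sum_le])
        (simp add: up_coeff_nonneg)
    then have "(\<lambda>n. \<Sum>k\<le>n. ?f k) \<longlonglongrightarrow> suminf ?f" by (simp add: summable_LIMSEQ')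
    then have "suminf ?f \<le> up_total z * t z"
      by (rule LIMSEQ_le_const2) (use up_coeff_weighted_partial_sum_le in auto)
    moreover have "(\<lambda>n. ?f (Suc n)) sums suminf ?f"
      using s by (subst sums_Suc_iff) (simp add: summable_sums)
    ultimately show ?thesis
      by (auto simp: fps_sums_def up_fps_def up_coeff_nonneg fps_deriv_nth[abs_def] simp del: up_coeff.simps)
  qed
  then obtain N where N: "\<And>z. fps_sums (fps_deriv (up_fps z)) (N z)" "\<And>z. N z \<le> up_total z * t z"
    by metis
  have N_eq: "N z = a z / 2 * (1 + up_total (z - 1) * up_total z +
      (up_total (z - 1) * N z + N (z - 1) * up_total z))" for z
  proof -
    have "fps_deriv (up_fps z) = fps_const (a z / 2) * (fps_X *
        (up_fps (z - 1) * fps_deriv (up_fps z) + fps_deriv (up_fps (z - 1)) * up_fps z) +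
        (1 + up_fps (z - 1) * up_fps z))"
      by (subst up_fps_eq) simp
    moreover have "fps_sums (fps_const (a z / 2) * (fps_X *
        (up_fps (z - 1) * fps_deriv (up_fps z) + fps_deriv (up_fps (z - 1)) * up_fps z) +
        (1 + up_fps (z - 1) * up_fps z)))
        (a z / 2 * (1 * (up_total (z - 1) * N z + N (z - 1) * up_total z) +
        (1 + up_total (z - 1) * up_total z)))"
      using a01(1)[of z]
      by (intro fps_sums_mult fps_sums_add fps_sums_1 fps_sums_X fps_sums_const up_fps_sums N) auto
    ultimately have "N z = a z / 2 * (1 * (up_total (z - 1) * N z + N (z - 1) * up_total z) +
        (1 + up_total (z - 1) * up_total z))"
      using fps_sums_unique[OF N(1)[of z]] by metis
    then show ?thesis by (simp only: mult_1 ac_simps)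
  qed
  define s where "s z = N z / up_total z" for z
  have Ns: "N z = up_total z * s z" for z using up_total_bounds(1)[of z] by (simp add: s_def)
  have s_eq: "s z = 1 + up_total z * up_total (z - 1) * (1 + s (z - 1))" for z
  proof -
    let ?G = "up_total z" and ?H = "up_total (z - 1)"
    have G: "?G = a z / 2 * (1 + ?H * ?G)" by (rule up_total_eq)
    have e: "?G * s z = a z / 2 * (1 + ?H * ?G + (?H * (?G * s z) + (?H * s (z - 1)) * ?G))"
      using N_eq[of z] unfolding Ns .
    have "a z / 2 * (1 + ?H * ?G) * s z = ?G * s z" using G by simp
    with e have "a z / 2 * s z = a z / 2 * (1 + ?G * ?H * (1 + s (z - 1)))"
      by (simp add: algebra_simps)
    then show ?thesis using a01(1)[of z] by simp
  qed
  have s_nn: "0 \<le> s z" for z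
    using fps_sums_nonneg[OF N(1)[of z]] up_total_bounds(1)[of z] by (simp add: s_def)
  have "up_time (left_window a m z) \<le> s z" for m z
  proof (induction m arbitrary: z)
    case (Suc m)
    have "up_prob (left_window a (Suc m) z) * up_prob (left_window a m (z - 1)) *
        (1 + up_time (left_window a m (z - 1))) \<le> up_total z * up_total (z - 1) * (1 + s (z - 1))"
      using Suc[of "z - 1"] up_total_bounds[of z] up_total_bounds[of "z - 1"]
      by (intro mult_mono up_prob_le_up_total add_left_mono mult_nonneg_nonneg up_prob_bounds
          add_nonneg_nonneg up_time_nonneg left_window_unit) auto
    then show ?case using s_eq[of z] by (simp add: left_window_Suc)
  qed (simp add: s_nn)
  then have "t z \<le> s z" for z by (intro LIMSEQ_le_const2[OF t_lim]) auto
  then have "up_total x * t x \<le> N x"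
    unfolding Ns using up_total_bounds[of x] by (intro mult_left_mono) auto
  then show ?thesis using N[of x] by (metis order_antisym)
qed

lemma hit_coeff_sums:
  assumes "x \<le> y"
  shows "\<And>n. 0 \<le> hit_coeff y n x"
    and "(\<lambda>n. hit_coeff y n x) sums (\<Prod>j\<in>{x..<y}. up_total j)"
    and "(\<lambda>n. real n * hit_coeff y n x) sums ((\<Prod>j\<in>{x..<y}. up_total j) * (\<Sum>j\<in>{x..<y}. t j))"
proof -
  have P: "fps_sums (\<Prod>j\<in>{x..<y}. up_fps j) (\<Prod>j\<in>{x..<y}. up_total j)"
    and D: "fps_sums (fps_deriv (\<Prod>j\<in>{x..<y}. up_fps j))
      ((\<Prod>j\<in>{x..<y}. up_total j) * (\<Sum>j\<in>{x..<y}. t j))"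
    using fps_sums_prod[of "{x..<y}" up_fps up_total t] up_fps_sums up_fps_deriv_sums by auto
  show "\<And>n. 0 \<le> hit_coeff y n x" "(\<lambda>n. hit_coeff y n x) sums (\<Prod>j\<in>{x..<y}. up_total j)"
    using P by (auto simp: fps_sums_def hit_coeff_eq_prod[OF assms])
  have "(\<lambda>n. real (Suc n) * hit_coeff y (Suc n) x) sums
      ((\<Prod>j\<in>{x..<y}. up_total j) * (\<Sum>j\<in>{x..<y}. t j))"
    using D unfolding fps_sums_def hit_coeff_eq_prod[OF assms] by (simp add: fps_deriv_nth[abs_def])
  then show "(\<lambda>n. real n * hit_coeff y n x) sums ((\<Prod>j\<in>{x..<y}. up_total j) * (\<Sum>j\<in>{x..<y}. t j))"
    by (subst (asm) sums_Suc_iff) simp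
qed

end

end

end

section \<open>First passage of the killed walk\<close>

lemma measurable_killed_walk_component [measurable]:
  "(\<lambda>S. S i) \<in> measurable (killed_walk U) (count_space UNIV)"
  unfolding measurable_cong_sets[OF sets_killed_walk refl]
  by (rule measurable_component_singleton) simp

text \<open>
  The Markov property for first passage times, for the cylinder sets on which the law of the walk is
  known. The induction on \<open>n\<close> extends the prescribed initial path by one step.
\<close>

lemma emeasure_first_passage_from_path:
  assumes U: "\<And>z. 0 \<le> U z"
  shows "emeasure (killed_walk U) {S. (\<forall>i\<le>k. S i = x i) \<and> S (k + n) = Some y \<and>
      (\<forall>i. k \<le> i \<and> i < k + n \<longrightarrow> S i \<noteq> Some y)} =
    emeasure (killed_walk U) {S. \<forall>i\<le>k. S i = x i} *
      ennreal (case x k of None \<Rightarrow> 0 | Some z \<Rightarrow> hit_coeff (\<lambda>z. exp (- U z)) y n z)"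
proof (induction n arbitrary: k x)
  case 0
  have "{S. (\<forall>i\<le>k. S i = x i) \<and> S (k + 0) = Some y \<and> (\<forall>i. k \<le> i \<and> i < k + 0 \<longrightarrow> S i \<noteq> Some y)} =
      (if x k = Some y then {S. \<forall>i\<le>k. S i = x i} else {})"
    by auto
  then show ?case by (auto split: option.split)
next
  case (Suc n)
  let ?a = "\<lambda>z. exp (- U z)"
  let ?c = "\<lambda>k x. emeasure (killed_walk U) {S. \<forall>i\<le>k. S i = x i}"
  let ?w = "\<lambda>n s. case s of None \<Rightarrow> 0 | Some z \<Rightarrow> hit_coeff ?a y n z"
  let ?E = "\<lambda>k x n. {S. (\<forall>i\<le>k. S i = x i) \<and> S (k + n) = Some y \<and>
      (\<forall>i. k \<le> i \<and> i < k + n \<longrightarrow> S i \<noteq> Some y)}"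
  show ?case
  proof (cases "x k = Some y")
    case True
    then have E: "?E k x (Suc n) = {}" by auto
    show ?thesis unfolding E using True by simp
  next
    case False
    have hn: "0 \<le> hit_coeff ?a y m z" for m z
      by (induction m arbitrary: z) auto
    have E: "?E k x (Suc n) = (\<Union>s. ?E (Suc k) (x(Suc k := s)) n)"
    proof (intro equalityI subsetI)
      fix S assume "S \<in> ?E k x (Suc n)"
      then have "S \<in> ?E (Suc k) (x(Suc k := S (Suc k))) n" by (auto simp: le_Suc_eq)
      then show "S \<in> (\<Union>s. ?E (Suc k) (x(Suc k := s)) n)" by blast
    next
      fix S assume "S \<in> (\<Union>s. ?E (Suc k) (x(Suc k := s)) n)"
      then obtain s where S: "S \<in> ?E (Suc k) (x(Suc k := s)) n" by blast
      then have *: "S i = x i" if "i \<le> k" for i using that by auto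
      have "S i \<noteq> Some y" if "k \<le> i" "i < k + Suc n" for i
        using S False *[of k] that by (cases "i = k") auto
      then show "S \<in> ?E k x (Suc n)" using S * by auto
    qed
    have "emeasure (killed_walk U) (?E k x (Suc n)) =
        (\<integral>\<^sup>+ s. emeasure (killed_walk U) (?E (Suc k) (x(Suc k := s)) n) \<partial>count_space UNIV)"
      unfolding E
    proof (rule emeasure_UN_countable)
      show "?E (Suc k) (x(Suc k := s)) n \<in> sets (killed_walk U)" for s
      proof -
        have "{S \<in> space (killed_walk U). (\<forall>i\<le>Suc k. S i = (x(Suc k := s)) i) \<and> S (Suc k + n) = Some y \<and>
          (\<forall>i. Suc k \<le> i \<and> i < Suc k + n \<longrightarrow> S i \<noteq> Some y)} \<in> sets (killed_walk U)"
          by measurable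
        then show ?thesis by (simp add: space_killed_walk)
      qed
      show "disjoint_family_on (\<lambda>s. ?E (Suc k) (x(Suc k := s)) n) UNIV"
        by (auto simp: disjoint_family_on_def)
    qed auto
    also have "\<dots> = (\<integral>\<^sup>+ s. ?c k x * ennreal (pmf (walk_step U (x k)) s * ?w n s) \<partial>count_space UNIV)"
    proof (rule nn_integral_cong)
      fix s :: "int option"
      have cyl: "?c (Suc k) (x(Suc k := s)) = ?c k x * ennreal (pmf (walk_step U (x k)) s)"
        unfolding emeasure_killed_walk
        by (subst ennreal_mult[symmetric]) (auto intro!: mult_nonneg_nonneg prod_nonneg)
      then show "emeasure (killed_walk U) (?E (Suc k) (x(Suc k := s)) n) =
          ?c k x * ennreal (pmf (walk_step U (x k)) s * ?w n s)"
        unfolding Suc cyl by (simp add: ennreal_mult' mult.assoc)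
    qed
    also have "\<dots> = ?c k x * (\<integral>\<^sup>+ s. ennreal (pmf (walk_step U (x k)) s * ?w n s) \<partial>count_space UNIV)"
      by (rule nn_integral_cmult) simp
    also have "(\<integral>\<^sup>+ s. ennreal (pmf (walk_step U (x k)) s * ?w n s) \<partial>count_space UNIV) = ennreal (?w (Suc n) (x k))"
    proof (cases "x k")
      case None
      then have "(\<integral>\<^sup>+ s. ennreal (pmf (walk_step U (x k)) s * ?w n s) \<partial>count_space UNIV) =
        (\<integral>\<^sup>+ s. 0 \<partial>count_space (UNIV :: int option set))"
        by (intro nn_integral_cong) (auto simp: pmf_walk_step_None split: option.split)
      then show ?thesis using None by simp
    next
      case (Some z)
      have "(\<integral>\<^sup>+ s. ennreal (pmf (walk_step U (x k)) s * ?w n s) \<partial>count_space UNIV) =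
        (\<Sum>s\<in>{Some (z - 1), Some (z + 1)}. ennreal (pmf (walk_step U (x k)) s * ?w n s))"
      proof (rule nn_integral_count_space')
        fix s assume "s \<notin> {Some (z - 1), Some (z + 1)}"
        then show "ennreal (pmf (walk_step U (x k)) s * ?w n s) = 0"
          using U Some by (cases s) (auto simp: pmf_walk_step_Some)
      qed auto
      also have "\<dots> = ennreal (?w (Suc n) (x k))"
        using Some False U hn
        by (simp add: pmf_walk_step_Some ennreal_plus[symmetric] algebra_simps del: ennreal_plus)
      finally show ?thesis .
    qed
    finally show ?thesis .
  qed
qed

lemma hitting_time_eq_enat_iff:
  "hitting_time y S = enat n \<longleftrightarrow> 0 < n \<and> S n = Some y \<and> (\<forall>i. 0 < i \<and> i < n \<longrightarrow> S i \<noteq> Some y)"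
proof -
  let ?A = "{n. 0 < n \<and> S n = Some y}"
  have min: "hitting_time y S = enat m" if "m \<in> ?A" "\<And>i. i \<in> ?A \<Longrightarrow> m \<le> i" for m
    unfolding hitting_time_def using that
    by (intro antisym INF_lower INF_greatest) auto
  show ?thesis
  proof
    assume h: "hitting_time y S = enat n"
    have "hitting_time y S = \<infinity>" if "?A = {}"
      unfolding hitting_time_def that by (simp add: Inf_enat_def)
    with h have "?A \<noteq> {}" by (metis enat.distinct(2))
    then have L: "(LEAST m. m \<in> ?A) \<in> ?A" "\<And>i. i \<in> ?A \<Longrightarrow> (LEAST m. m \<in> ?A) \<le> i"
      using LeastI[of "\<lambda>m. m \<in> ?A"] Least_le[of "\<lambda>m. m \<in> ?A"] by blast+
    then have "n = (LEAST m. m \<in> ?A)" using h min[OF L] by simp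
    then show "0 < n \<and> S n = Some y \<and> (\<forall>i. 0 < i \<and> i < n \<longrightarrow> S i \<noteq> Some y)"
      using L by (metis (mono_tags, lifting) leD mem_Collect_eq)
  next
    assume "0 < n \<and> S n = Some y \<and> (\<forall>i. 0 < i \<and> i < n \<longrightarrow> S i \<noteq> Some y)"
    then show "hitting_time y S = enat n"
      by (intro min) (auto simp: not_less[symmetric])
  qed
qed

lemma AE_killed_walk_start: "AE S in killed_walk U. S 0 = Some 0"
proof -
  have "AE S in killed_walk U. s \<noteq> Some 0 \<longrightarrow> S 0 \<noteq> s" for s
  proof (cases "s = Some 0")
    case False
    have "{S \<in> space (killed_walk U). S 0 = s} \<in> sets (killed_walk U)" by measurable
    then have "{S \<in> space (killed_walk U). S 0 = s} \<in> null_sets (killed_walk U)"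
      using emeasure_killed_walk[of U 0 "\<lambda>_. s"] False
      by (intro null_setsI) (auto simp: space_killed_walk)
    then show ?thesis by (rule AE_I') auto
  qed simp
  then have "AE S in killed_walk U. \<forall>s. s \<noteq> Some 0 \<longrightarrow> S 0 \<noteq> s"
    by (simp add: AE_all_countable)
  then show ?thesis by (rule AE_mp) auto
qed

lemma sets_hitting_time_eq [measurable]:
  "{S. hitting_time y S = enat n} \<in> sets (killed_walk U)"
proof -
  have "{S \<in> space (killed_walk U). 0 < n \<and> S n = Some y \<and> (\<forall>i. 0 < i \<and> i < n \<longrightarrow> S i \<noteq> Some y)}
      \<in> sets (killed_walk U)"
    by measurable
  then show ?thesis by (simp add: space_killed_walk hitting_time_eq_enat_iff)
qed

text \<open>
  For \<open>y \<noteq> 0\<close> it makes no difference that \<open>hit_coeff\<close> counts a visit at time \<open>0\<close> and \<open>hitting_time\<close> does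
  not.
\<close>

lemma emeasure_hitting_time_eq:
  assumes "\<And>z. 0 \<le> U z" "y \<noteq> 0"
  shows "emeasure (killed_walk U) {S. hitting_time y S = enat n} =
    ennreal (hit_coeff (\<lambda>z. exp (- U z)) y n 0)"
proof (cases n)
  case 0
  then show ?thesis using assms by (simp add: hitting_time_eq_enat_iff)
next
  case (Suc m)
  let ?E = "{S. (\<forall>i\<le>0. S i = Some 0) \<and> S (0 + n) = Some y \<and>
      (\<forall>i. 0 \<le> i \<and> i < 0 + n \<longrightarrow> S i \<noteq> Some y)}"
  have "{S \<in> space (killed_walk U). (\<forall>i\<le>0. S i = Some 0) \<and> S (0 + n) = Some y \<and>
      (\<forall>i. 0 \<le> i \<and> i < 0 + n \<longrightarrow> S i \<noteq> Some y)} \<in> sets (killed_walk U)"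
    by measurable
  then have "emeasure (killed_walk U) {S. hitting_time y S = enat n} = emeasure (killed_walk U) ?E"
    using sets_hitting_time_eq[where y = y and n = n and U = U] AE_killed_walk_start[of U]
  proof (intro emeasure_eq_AE)
    assume "AE S in killed_walk U. S 0 = Some 0"
    then show "AE S in killed_walk U. S \<in> {S. hitting_time y S = enat n} \<longleftrightarrow> S \<in> ?E"
    proof eventually_elim
      case (elim S)
      then have "S i \<noteq> Some y" if "i = 0" for i using that assms(2) by simp
      then have "(\<forall>i. 0 < i \<and> i < n \<longrightarrow> S i \<noteq> Some y) \<longleftrightarrow> (\<forall>i. 0 \<le> i \<and> i < 0 + n \<longrightarrow> S i \<noteq> Some y)"
        by (metis add_0 le0 neq0_conv)
      then show ?case using elim Suc by (simp add: hitting_time_eq_enat_iff)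
    qed
  qed (simp_all add: space_killed_walk)
  also have "\<dots> = ennreal (hit_coeff (\<lambda>z. exp (- U z)) y n 0)"
    using emeasure_first_passage_from_path[where U = U and k = 0 and x = "\<lambda>_. Some 0" and n = n and y = y, OF assms(1)]
      emeasure_killed_walk[of U 0 "\<lambda>_. Some 0"] by simp
  finally show ?thesis .
qed

text \<open>
  The conditional mean is the quotient of the first moment and the total mass of the law of the hitting
  time; the product of the \<open>up_total\<close> cancels.
\<close>

lemma quenched_mean_time_eq:
  assumes U: "\<And>z. 0 \<le> U z" and y: "0 < y"
    and t: "\<And>x. (\<lambda>m. up_time (left_window (\<lambda>z. exp (- U z)) m x)) \<longlonglongrightarrow> t x"
  shows "quenched_mean_time U y = ennreal (\<Sum>x<y. t (int x))"
proof -
  let ?a = "\<lambda>z. exp (- U z)" and ?K = "killed_walk U" and ?T = "hitting_time (int y)"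
  let ?h = "\<lambda>n. hit_coeff ?a (int y) n 0"
  have a: "\<And>x. 0 < ?a x" "\<And>x. ?a x \<le> 1" using U by auto
  define G where "G = (\<Prod>j\<in>{0..<int y}. up_total ?a j)"
  define s where "s = (\<Sum>j\<in>{0..<int y}. t j)"
  have h: "\<And>n. 0 \<le> ?h n" "?h sums G" "(\<lambda>n. real n * ?h n) sums (G * s)"
    unfolding G_def s_def using hit_coeff_sums[OF a t, of 0 "int y"] by auto
  have Gp: "0 < G" unfolding G_def using up_total_bounds(1)[OF a] by (intro prod_pos) auto
  have s_eq: "s = (\<Sum>x<y. t (int x))"
    unfolding s_def by (rule sum.reindex_bij_witness[of _ int nat]) auto
  have em: "emeasure ?K {S. ?T S = enat n} = ennreal (?h n)" for n
    using emeasure_hitting_time_eq[where U = U, OF U] y by simp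
  have A: "{S \<in> space ?K. ?T S < \<infinity>} = (\<Union>n. {S. ?T S = enat n})"
    by (auto simp: space_killed_walk less_infinityE)
  have "emeasure ?K (\<Union>n. {S. ?T S = enat n}) = (\<Sum>n. emeasure ?K {S. ?T S = enat n})"
    by (rule suminf_emeasure[symmetric]) (auto simp: disjoint_family_on_def)
  also have "\<dots> = ennreal G"
    unfolding em by (rule suminf_ennreal_eq) (use h in auto)
  finally have PA: "emeasure ?K {S \<in> space ?K. ?T S < \<infinity>} = ennreal G" unfolding A .
  have meas: "(\<lambda>S. ennreal_of_enat (?T S)) \<in> borel_measurable ?K"
  proof -
    have "?T \<in> measurable ?K (count_space UNIV)"
    proof (subst measurable_count_space_eq_countable)
      have "?T -` {e} \<inter> space ?K \<in> sets ?K" for e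
      proof (cases e)
        case (enat n)
        then have "?T -` {e} \<inter> space ?K = {S. ?T S = enat n}" by (auto simp: space_killed_walk)
        then show ?thesis by simp
      next
        case infinity
        then have "?T -` {e} \<inter> space ?K = space ?K - (\<Union>n. {S. ?T S = enat n})"
          by (auto simp: space_killed_walk)
        then show ?thesis by auto
      qed
      then show "?T \<in> space ?K \<rightarrow> UNIV \<and> (\<forall>e\<in>UNIV. ?T -` {e} \<inter> space ?K \<in> sets ?K)" by auto
    qed auto
    then show ?thesis by simp
  qed
  have "(\<integral>\<^sup>+ S. ennreal_of_enat (?T S) * indicator {S \<in> space ?K. ?T S < \<infinity>} S \<partial>?K) =
      (\<integral>\<^sup>+ S. (\<Sum>n. ennreal (real n) * indicator {S. ?T S = enat n} S) \<partial>?K)"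
  proof (rule nn_integral_cong)
    fix S
    show "ennreal_of_enat (?T S) * indicator {S \<in> space ?K. ?T S < \<infinity>} S =
      (\<Sum>n. ennreal (real n) * indicator {S. ?T S = enat n} S)"
    proof (cases "?T S")
      case (enat m)
      have "(\<Sum>n. ennreal (real n) * indicator {S. ?T S = enat n} S) =
        (\<Sum>n\<in>{m}. ennreal (real n) * indicator {S. ?T S = enat n} S)"
        by (rule suminf_finite) (auto simp: enat)
      then show ?thesis using enat by (simp add: space_killed_walk ennreal_of_nat_eq_real_of_nat)
    qed simp
  qed
  also have "\<dots> = (\<Sum>n. \<integral>\<^sup>+ S. ennreal (real n) * indicator {S. ?T S = enat n} S \<partial>?K)"
    by (rule nn_integral_suminf) simp
  also have "\<dots> = (\<Sum>n. ennreal (real n * ?h n))"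
    by (simp add: nn_integral_cmult em ennreal_mult')
  also have "\<dots> = ennreal (G * s)" using h by (intro suminf_ennreal_eq) auto
  finally have I: "(\<integral>\<^sup>+ S. ennreal_of_enat (?T S) * indicator {S \<in> space ?K. ?T S < \<infinity>} S \<partial>?K) = ennreal (G * s)" .
  have "{S \<in> space ?K. ?T S < \<infinity>} \<in> sets ?K" unfolding A by auto
  then have "quenched_mean_time U y = ennreal (G * s) / ennreal G"
    unfolding quenched_mean_time_def quenched_path_measure_def
    by (subst nn_integral_uniform_measure[OF meas]) (simp_all only: I PA)
  also have "\<dots> = ennreal s"
    using Gp sums_le[OF _ sums_zero h(3)] h(1)
    by (subst divide_ennreal) (auto simp: zero_le_mult_iff)
  finally show ?thesis using s_eq by simp
qed

section \<open>Mean passage time in terms of the gap to the last obstacle\<close>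

text \<open>
  The expectation of \<open>F\<close> at a word of \<open>n\<close> independent bits, each \<open>True\<close> (an obstacle) with probability
  \<open>p\<close>. As a recursion it exposes one site at a time, which is how the mean passage time is estimated.
\<close>

primrec bernoulli_mean :: "real \<Rightarrow> nat \<Rightarrow> (bool list \<Rightarrow> real) \<Rightarrow> real" where
  "bernoulli_mean p 0 F = F []"
| "bernoulli_mean p (Suc n) F =
    p * bernoulli_mean p n (\<lambda>l. F (True # l)) + (1 - p) * bernoulli_mean p n (\<lambda>l. F (False # l))"

lemma bernoulli_mean_const: "bernoulli_mean p n (\<lambda>_. c) = c"
  by (induction n) (auto simp: algebra_simps)

lemma bernoulli_mean_add:
  "bernoulli_mean p n (\<lambda>l. F l + G l) = bernoulli_mean p n F + bernoulli_mean p n G"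
  by (induction n arbitrary: F G) (auto simp: algebra_simps)

lemma bernoulli_mean_cmult: "bernoulli_mean p n (\<lambda>l. c * F l) = c * bernoulli_mean p n F"
  by (induction n arbitrary: F) (auto simp: algebra_simps)

lemma bernoulli_mean_mono:
  assumes "0 \<le> p" "p \<le> 1" "\<And>l. length l = n \<Longrightarrow> F l \<le> G l"
  shows "bernoulli_mean p n F \<le> bernoulli_mean p n G"
  using assms(3)
  by (induction n arbitrary: F G) (use assms(1,2) in \<open>auto intro!: add_mono mult_left_mono\<close>)

lemma bernoulli_mean_split:
  "bernoulli_mean p (m + n) (\<lambda>l. F (take m l) * G (drop m l)) =
    bernoulli_mean p m F * bernoulli_mean p n G"
proof (induction m arbitrary: F)
  case 0
  then show ?case by (simp add: bernoulli_mean_cmult)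
next
  case (Suc m)
  show ?case
    using Suc[of "\<lambda>l. F (True # l)"] Suc[of "\<lambda>l. F (False # l)"] by (simp add: algebra_simps)
qed

text \<open>
  The number of free sites before the first obstacle. A word without obstacle counts in full, because
  the wall behind its end acts like an impenetrable obstacle.
\<close>

fun gap :: "bool list \<Rightarrow> nat" where
  "gap [] = 0"
| "gap (True # l) = 0"
| "gap (False # l) = Suc (gap l)"

lemma bernoulli_mean_gap:
  assumes "p \<noteq> 0"
  shows "bernoulli_mean p n (\<lambda>l. real (gap l)) = (1 - p) * (1 - (1 - p) ^ n) / p"
proof (induction n)
  case (Suc n)
  have "bernoulli_mean p (Suc n) (\<lambda>l. real (gap l)) = (1 - p) * (1 + bernoulli_mean p n (\<lambda>l. real (gap l)))"
    by (simp add: bernoulli_mean_add bernoulli_mean_const)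
  then show ?case using assms unfolding Suc by (simp add: field_simps)
qed simp

lemma bernoulli_mean_pred_gap:
  assumes "p \<noteq> 0"
  shows "bernoulli_mean p (Suc n) (\<lambda>l. real (gap l - 1)) = (1 - p)\<^sup>2 * (1 - (1 - p) ^ n) / p"
  using bernoulli_mean_gap[OF assms, of n] by (simp add: bernoulli_mean_const power2_eq_square)

definition survival :: "real \<Rightarrow> bool \<Rightarrow> real" where
  "survival r b = (if b then r else 1)"

lemma survival_simps [simp]: "survival r True = r" "survival r False = 1"
  by (simp_all add: survival_def)

definition window_time :: "real \<Rightarrow> bool list \<Rightarrow> real" where
  "window_time r l = up_time (map (survival r) l)"

text \<open>The mean passage time over one site when the obstacles are impenetrable.\<close>

definition mean_lower :: "real \<Rightarrow> real" where
  "mean_lower p = (2 - p + 2 * p\<^sup>2) / (3 * p)"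

lemma mean_lower_eq: "p \<noteq> 0 \<Longrightarrow> mean_lower p = 1 + 2 / 3 * ((1 - p)\<^sup>2 / p)"
  by (simp add: mean_lower_def field_simps power2_eq_square)

text \<open>
  A walk at an obstacle with survival probability \<open>r\<close> ever steps above it with probability at most
  \<open>r / (2 - r) = 1 - 1 / c\<close>, where \<open>c - 1 = r / (2 - 2 * r)\<close>. As the starting value of the solution
  \<open>1 - 1 / (k + c)\<close> along a gap, this shifts \<open>k\<close> by \<open>c - 1\<close> from its value for an impenetrable obstacle.
\<close>

definition wall_defect :: "real \<Rightarrow> real" where
  "wall_defect r = r / (2 - 2 * r)"

context
  fixes r :: real
  assumes r: "0 < r" "r < 1"
begin

lemma survival_bounds: "0 < survival r b" "survival r b \<le> 1"
  using r by (auto simp: survival_def)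

lemma survival_unit: "set (map (survival r) l) \<subseteq> {0..1}"
  using survival_bounds by (auto simp: less_imp_le)

lemma window_time_nonneg: "0 \<le> window_time r l"
  unfolding window_time_def by (rule up_time_nonneg[OF survival_unit])

text \<open>Comparison with an impenetrable obstacle, for which equality holds.\<close>

lemma gap_le_up_prob: "gap l / (gap l + 1) \<le> up_prob (map (survival r) l)"
proof (induction l rule: gap.induct)
  case (2 l)
  then show ?case using up_prob_bounds[OF survival_unit[of "True # l"]] by simp
next
  case (3 l)
  define k where "k = real (gap l)"
  have k: "0 \<le> k" by (simp add: k_def)
  have "(k + 1) / (k + 2) = 1 / (2 - 1 * (k / (k + 1)))" using k by (simp add: field_simps)
  also have "\<dots> \<le> 1 / (2 - 1 * up_prob (map (survival r) l))"
    using 3 up_prob_bounds[OF survival_unit[of l]] by (intro up_step_mono) (auto simp: k_def add.commute)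
  finally show ?case by (simp add: k_def add.commute)
qed simp

text \<open>
  On a gap of length \<open>k\<close> above an impenetrable obstacle, the recursion for the time is solved by
  \<open>(2 * k + 1) / 3 = 1 + 2 / 3 * (k - 1)\<close>. At the obstacle itself the time is at least \<open>1\<close>, to which
  the truncated subtraction in the statement reduces for \<open>k = 0\<close>.
\<close>

lemma window_time_ge: "l \<noteq> [] \<Longrightarrow> 1 + 2 / 3 * real (gap l - 1) \<le> window_time r l"
proof (induction l rule: gap.induct)
  case (2 l)
  then show ?case
    using up_prob_bounds[OF survival_unit[of "True # l"]] up_prob_bounds[OF survival_unit[of l]]
      window_time_nonneg[of l]
    by (auto simp: window_time_def simp del: up_prob.simps)
next
  case (3 l)
  let ?g = "up_prob (map (survival r) l)" and ?h = "up_prob (map (survival r) (False # l))"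
  have h: "0 \<le> ?h" "0 \<le> ?g" using up_prob_bounds[OF survival_unit] by blast+
  have t: "window_time r (False # l) = 1 + ?h * ?g * (1 + window_time r l)"
    by (simp add: window_time_def)
  show ?case
  proof (cases "gap l = 0")
    case True
    then show ?thesis using h window_time_nonneg[of l] unfolding t by (simp del: up_prob.simps)
  next
    case False
    define k where "k = real (gap l)"
    have k: "1 \<le> k" using False by (simp add: k_def)
    have g1: "real (gap l - 1) = k - 1" using False by (simp add: k_def of_nat_diff)
    have "l \<noteq> []" using False by auto
    then have IH: "1 + 2 / 3 * (k - 1) \<le> window_time r l" using 3 g1 by simp
    have "2 / 3 * k = ((k + 1) / (k + 2)) * (k / (k + 1)) * (1 + (1 + 2 / 3 * (k - 1)))"
    proof -
      have "a / b * (k / a) = k / b" if "a \<noteq> 0" for a b using that by simp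
      from this[of "k + 1" "k + 2"] have 1: "(k + 1) / (k + 2) * (k / (k + 1)) = k / (k + 2)" using k by simp
      have 2: "1 + (1 + 2 / 3 * (k - 1)) = 2 / 3 * (k + 2)" by (simp add: field_simps)
      have "2 / 3 * k = k / m * (2 / 3 * m)" if "m \<noteq> 0" for m using that by simp
      from this[of "k + 2"] show ?thesis unfolding 1 2 using k by simp
    qed
    also have "\<dots> \<le> ?h * ?g * (1 + window_time r l)"
      using gap_le_up_prob[of "False # l"] gap_le_up_prob[of l] IH k h
      by (intro mult_mono mult_nonneg_nonneg) (auto simp: k_def add.commute simp del: up_prob.simps)
    finally show ?thesis unfolding t by (simp add: k_def)
  qed
qed simp

lemma mean_window_time_ge:
  assumes p: "0 < p" "p \<le> 1"
  shows "1 + 2 / 3 * ((1 - p)\<^sup>2 * (1 - (1 - p) ^ n) / p) \<le> bernoulli_mean p (Suc n) (window_time r)"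
proof -
  have "1 + 2 / 3 * ((1 - p)\<^sup>2 * (1 - (1 - p) ^ n) / p) =
      bernoulli_mean p (Suc n) (\<lambda>l. 1 + 2 / 3 * real (gap l - 1))"
    using bernoulli_mean_pred_gap[of p n] p
    by (simp only: bernoulli_mean_add bernoulli_mean_const bernoulli_mean_cmult)
  also have "\<dots> \<le> bernoulli_mean p (Suc n) (window_time r)"
    using p by (intro bernoulli_mean_mono window_time_ge) auto
  finally show ?thesis .
qed

context
  fixes C :: real
  assumes C: "C = 1 + wall_defect r"
begin

lemma C_gt_1: "1 < C"
  using r by (simp add: C wall_defect_def)

lemma wall_up_prob: "r / (2 - r) = (C - 1) / C"
proof -
  have 1: "C = (2 - r) / (2 - 2 * r)" using r by (simp add: C wall_defect_def field_simps)
  have 2: "C - 1 = r / (2 - 2 * r)" by (simp add: C wall_defect_def)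
  show ?thesis unfolding 2 unfolding 1 using r by simp
qed

lemma up_prob_le_gap: "up_prob (map (survival r) l) \<le> (gap l + C - 1) / (gap l + C)"
proof (induction l rule: gap.induct)
  case 1
  then show ?case using C_gt_1 by simp
next
  case (2 l)
  have "r / (2 - r * up_prob (map (survival r) l)) \<le> r / (2 - r * 1)"
    using r up_prob_bounds[OF survival_unit[of l]] by (intro up_step_mono) auto
  then show ?case using wall_up_prob by simp
next
  case (3 l)
  define k where "k = real (gap l) + C"
  have k: "1 < k" using C_gt_1 by (simp add: k_def)
  have "1 / (2 - 1 * up_prob (map (survival r) l)) \<le> 1 / (2 - 1 * ((k - 1) / k))"
    using 3 k up_prob_bounds[OF survival_unit[of l]] by (intro up_step_mono) (auto simp: k_def)
  also have "\<dots> = k / (k + 1)" using k by (simp add: field_simps)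
  finally show ?case by (simp add: k_def algebra_simps)
qed

text \<open>
  With \<open>k = gap l + C\<close>, the function \<open>(2 * k - 1) / 3\<close> solves the recursion along the gap exactly. At
  the obstacle the true time exceeds it by at most \<open>excess\<close>. Each further site multiplies the difference
  by \<open>(k - 1) / (k + 1)\<close>, and \<open>gap_weight\<close> is the product of these factors.
\<close>

fun excess :: "bool list \<Rightarrow> real" where
  "excess [] = 0"
| "excess (True # l) = 2 / 3 + (C - 1) / C * (1 + window_time r l)"
| "excess (False # l) = excess l"

definition gap_weight :: "nat \<Rightarrow> real" where
  "gap_weight k = C * (C - 1) / ((k + C) * (k + C - 1))"

lemma window_time_le: "window_time r l \<le> (2 * gap l + 2 * C - 1) / 3 + gap_weight (gap l) * excess l"
proof (induction l rule: gap.induct)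
  case 1
  then show ?case using C_gt_1 by (simp add: window_time_def)
next
  case (2 l)
  let ?g = "up_prob (map (survival r) l)" and ?h = "up_prob (map (survival r) (True # l))"
  have "?h * ?g * (1 + window_time r l) \<le> (C - 1) / C * 1 * (1 + window_time r l)"
    using up_prob_bounds[OF survival_unit[of l]] up_prob_bounds[OF survival_unit[of "True # l"]]
      up_prob_le_gap[of "True # l"] window_time_nonneg[of l]
    by (intro mult_right_mono mult_mono) (auto simp del: up_prob.simps)
  moreover have "window_time r (True # l) = 1 + ?h * ?g * (1 + window_time r l)"
    by (simp add: window_time_def)
  moreover have "gap_weight 0 = 1" using C_gt_1 by (simp add: gap_weight_def)
  moreover have "1 + z \<le> (2 * C - 1) / 3 + (2 / 3 + z)" for z using C_gt_1 by (simp add: field_simps)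
  from this[of "(C - 1) / C * (1 + window_time r l)"]
  have "1 + (C - 1) / C * 1 * (1 + window_time r l) \<le>
      (2 * real (gap (True # l)) + 2 * C - 1) / 3 + 1 * excess (True # l)" by simp
  ultimately show ?case by (simp only: gap.simps of_nat_0 mult_zero_right)
next
  case (3 l)
  let ?g = "up_prob (map (survival r) l)" and ?h = "up_prob (map (survival r) (False # l))"
  define k where "k = real (gap l) + C"
  have k: "1 < k" using C_gt_1 by (simp add: k_def)
  have "?h * ?g \<le> k / (k + 1) * ((k - 1) / k)"
    using up_prob_bounds[OF survival_unit[of l]] up_prob_bounds[OF survival_unit[of "False # l"]]
      up_prob_le_gap[of "False # l"] up_prob_le_gap[of l] k
    by (intro mult_mono) (auto simp: k_def algebra_simps simp del: up_prob.simps)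
  also have "\<dots> = (k - 1) / (k + 1)" using k by simp
  finally have "?h * ?g * (1 + window_time r l) \<le>
      (k - 1) / (k + 1) * (1 + ((2 * k - 1) / 3 + gap_weight (gap l) * excess l))"
    using 3 window_time_nonneg[of l] k
    by (intro mult_mono) (auto simp: k_def algebra_simps simp del: up_prob.simps)
  also have "\<dots> = (2 * (k + 1) - 1) / 3 - 1 + (k - 1) / (k + 1) * gap_weight (gap l) * excess l"
    using k by (simp add: field_simps)
  also have "(k - 1) / (k + 1) * gap_weight (gap l) = gap_weight (gap (False # l))"
    using k by (simp add: gap_weight_def k_def[symmetric] add.commute[of 1] add.assoc)
  finally show ?case by (simp add: window_time_def k_def algebra_simps del: up_prob.simps)
qed

text \<open>
  The weights telescope: \<open>1 / (k * (k - 1)) = 1 / (k - 1) - 1 / k\<close>. So the excess, although its weight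
  decays only quadratically in the gap, contributes to the mean no more than a bounded multiple of its
  largest mean value \<open>A\<close> at an obstacle, times the density \<open>p\<close>. The offset \<open>i\<close> is what the
  induction over the sites needs.
\<close>

lemma mean_excess_le:
  assumes p: "0 < p" "p \<le> 1"
    and A: "\<And>m. m < n \<Longrightarrow> 2 / 3 + (C - 1) / C * (1 + bernoulli_mean p m (window_time r)) \<le> A"
    and A0: "0 \<le> A"
  shows "bernoulli_mean p n (\<lambda>l. gap_weight (i + gap l) * excess l) \<le> p * A * (C * (C - 1)) / (i + C - 1)"
  using A
proof (induction n arbitrary: i)
  case 0
  then show ?case using p A0 C_gt_1 by (simp add: gap_weight_def)
next
  case (Suc n)
  have H: "0 < C * (C - 1)" using C_gt_1 by simp
  define k where "k = real i + C"
  have k: "1 < k" using C_gt_1 by (simp add: k_def)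
  have w: "gap_weight i = C * (C - 1) / (k * (k - 1))" by (simp add: gap_weight_def k_def)
  have wn: "0 \<le> gap_weight i" unfolding w using H k by (intro divide_nonneg_pos mult_pos_pos) auto
  have IH: "bernoulli_mean p n (\<lambda>l. gap_weight (Suc i + gap l) * excess l) \<le> p * A * (C * (C - 1)) / k"
    using Suc.IH[of "Suc i"] Suc.prems by (simp add: k_def)
  have "bernoulli_mean p (Suc n) (\<lambda>l. gap_weight (i + gap l) * excess l) =
      p * (gap_weight i * (2 / 3 + (C - 1) / C * (1 + bernoulli_mean p n (window_time r)))) +
      (1 - p) * bernoulli_mean p n (\<lambda>l. gap_weight (Suc i + gap l) * excess l)"
    by (simp only: bernoulli_mean.simps gap.simps excess.simps add_0_right add_Suc_right add_Suc
        bernoulli_mean_cmult bernoulli_mean_add bernoulli_mean_const)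
  also have "\<dots> \<le> p * (gap_weight i * A) + (1 - p) * (p * A * (C * (C - 1)) / k)"
    using p wn Suc.prems by (intro add_mono mult_left_mono IH) auto
  also have "\<dots> \<le> p * (gap_weight i * A) + 1 * (p * A * (C * (C - 1)) / k)"
    using p A0 H k by (intro add_left_mono mult_right_mono) auto
  also have "\<dots> = p * A * (C * (C - 1)) / (k - 1)"
    unfolding w using k by (simp add: divide_simps) (simp add: algebra_simps)
  finally show ?case by (simp add: k_def)
qed

text \<open>
  Let \<open>T\<close> be the right-hand side; it is the fixed point of \<open>T = L + 3 \<delta> + p \<delta> T\<close>. If shorter windows
  have mean at most \<open>T\<close>, then so has the stretch behind the first obstacle, and the bounds by gap and
  excess reproduce \<open>T\<close>.
\<close>

lemma mean_window_time_le:
  assumes p: "0 < p" "p \<le> 1" and small: "p * wall_defect r < 1"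
  shows "bernoulli_mean p n (window_time r) \<le> (mean_lower p + 3 * wall_defect r) / (1 - p * wall_defect r)"
proof (induction n rule: less_induct)
  case (less n)
  define T where "T = (mean_lower p + 3 * wall_defect r) / (1 - p * wall_defect r)"
  have C1: "wall_defect r = C - 1" by (simp add: C)
  have d: "0 < wall_defect r" using C_gt_1 by (simp add: C)
  have L: "1 \<le> mean_lower p" using p by (simp add: mean_lower_eq)
  have T0: "0 \<le> T" unfolding T_def using L d small by (intro divide_nonneg_pos) auto
  have T_eq: "T = mean_lower p + 3 * wall_defect r + p * wall_defect r * T"
    using small by (simp add: T_def field_simps)
  define A where "A = 2 / 3 + (C - 1) / C * (1 + T)"
  have CA: "C * A = 2 / 3 * C + (C - 1) * (1 + T)" using C_gt_1 by (simp add: A_def field_simps)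
  have A0: "0 \<le> A" unfolding A_def using C_gt_1 T0 by (intro add_nonneg_nonneg mult_nonneg_nonneg) auto
  have E: "bernoulli_mean p n (\<lambda>l. gap_weight (0 + gap l) * excess l) \<le> p * A * (C * (C - 1)) / (0 + C - 1)"
  proof (rule mean_excess_le[OF p _ A0, of n 0, simplified of_nat_0])
    show "2 / 3 + (C - 1) / C * (1 + bernoulli_mean p m (window_time r)) \<le> A" if "m < n" for m
      unfolding A_def using less[OF that] C_gt_1
      by (intro add_left_mono mult_left_mono) (auto simp: T_def)
  qed
  have E': "p * A * (C * (C - 1)) / (0 + C - 1) = p * (C * A)" using C_gt_1 by simp
  have g: "bernoulli_mean p n (\<lambda>l. real (gap l)) \<le> (1 - p) / p"
  proof -
    have "(1 - p) * (1 - (1 - p) ^ n) \<le> (1 - p) * 1" using p by (intro mult_left_mono) auto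
    then show ?thesis using p by (simp add: bernoulli_mean_gap divide_right_mono)
  qed
  have "bernoulli_mean p n (window_time r) \<le>
      bernoulli_mean p n (\<lambda>l. (2 * C - 1) / 3 + (2 / 3 * real (gap l) + gap_weight (0 + gap l) * excess l))"
  proof (rule bernoulli_mean_mono)
    show "window_time r l \<le> (2 * C - 1) / 3 + (2 / 3 * real (gap l) + gap_weight (0 + gap l) * excess l)" for l
      using window_time_le[of l] by (simp add: add_divide_distrib diff_divide_distrib)
  qed (use p in auto)
  also have "\<dots> \<le> (2 * C - 1) / 3 + (2 / 3 * ((1 - p) / p) + p * (C * A))"
    using E g unfolding E' bernoulli_mean_add bernoulli_mean_const bernoulli_mean_cmult
    by (intro add_mono add_left_mono mult_left_mono) auto
  also have "\<dots> = mean_lower p + wall_defect r * (2 / 3 + 5 / 3 * p) + p * wall_defect r * T"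
  proof -
    have "mean_lower p = 2 / 3 * ((1 - p) / p) + 1 / 3 + 2 / 3 * p"
      using p by (simp add: mean_lower_def field_simps power2_eq_square)
    moreover have "(2 * C - 1) / 3 + (2 / 3 * m + p * (2 / 3 * C + (C - 1) * (1 + T))) =
        2 / 3 * m + 1 / 3 + 2 / 3 * p + (C - 1) * (2 / 3 + 5 / 3 * p) + p * (C - 1) * T" for m
      by (simp add: field_simps)
    ultimately show ?thesis unfolding CA C1 by simp
  qed
  also have "\<dots> \<le> mean_lower p + wall_defect r * 3 + p * wall_defect r * T"
    using p d by (intro add_left_mono add_right_mono mult_left_mono) auto
  also have "\<dots> = T" using T_eq by simp
  finally show ?case unfolding T_def .
qed

end

end

section \<open>Ergodic averages\<close>

definition birkhoff_sum :: "('a \<Rightarrow> 'a) \<Rightarrow> ('a \<Rightarrow> real) \<Rightarrow> nat \<Rightarrow> 'a \<Rightarrow> real" where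
  "birkhoff_sum T f n x = (\<Sum>i<n. f ((T ^^ i) x))"

lemma birkhoff_sum_Suc: "birkhoff_sum T f (Suc n) x = f x + birkhoff_sum T f n (T x)"
  by (simp add: birkhoff_sum_def sum.lessThan_Suc_shift funpow_swap1 del: sum.lessThan_Suc)

text \<open>
  The maximum of the sums over \<open>0, 1, ..., n\<close> terms, in the recursive form on which the proof of the
  maximal ergodic theorem rests.
\<close>

primrec running_max :: "('a \<Rightarrow> 'a) \<Rightarrow> ('a \<Rightarrow> real) \<Rightarrow> nat \<Rightarrow> 'a \<Rightarrow> real" where
  "running_max T f 0 x = 0"
| "running_max T f (Suc n) x = max 0 (f x + running_max T f n (T x))"

lemma running_max_nonneg: "0 \<le> running_max T f n x"
  by (cases n) auto

lemma running_max_mono: "running_max T f n x \<le> running_max T f (Suc n) x"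
proof (induction n arbitrary: x)
  case (Suc n)
  from Suc[of "T x"] show ?case by (subst (1 2) running_max.simps(2)) linarith
qed simp

lemma birkhoff_sum_le_running_max: "n \<le> N \<Longrightarrow> birkhoff_sum T f n x \<le> running_max T f N x"
proof (induction N arbitrary: n x)
  case 0
  then show ?case by (simp add: birkhoff_sum_def)
next
  case (Suc N)
  show ?case
  proof (cases n)
    case 0
    then show ?thesis using running_max_nonneg by (simp add: birkhoff_sum_def)
  next
    case (Suc k)
    then show ?thesis using Suc.IH[of k "T x"] Suc.prems by (simp add: birkhoff_sum_Suc)
  qed
qed

locale measure_preserving = prob_space M for M :: "'a measure" +
  fixes T :: "'a \<Rightarrow> 'a"
  assumes T_measurable [measurable]: "T \<in> measurable M M"
    and distr_T: "distr M M T = M"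
begin

lemma funpow_measurable [measurable]: "(T ^^ n) \<in> measurable M M"
  by (induction n) (auto simp: comp_def intro: measurable_compose T_measurable)

lemma integral_T:
  fixes f :: "'a \<Rightarrow> real"
  assumes [measurable]: "f \<in> borel_measurable M"
  shows "(\<integral>x. f (T x) \<partial>M) = (\<integral>x. f x \<partial>M)"
  using integral_distr[OF T_measurable assms] by (simp add: distr_T)

lemma integrable_T:
  fixes f :: "'a \<Rightarrow> real"
  assumes "integrable M f"
  shows "integrable M (\<lambda>x. f (T x))"
  using integrable_distr[OF T_measurable, of f] assms by (simp add: distr_T)

lemma integral_funpow:
  fixes f :: "'a \<Rightarrow> real"
  assumes [measurable]: "f \<in> borel_measurable M"
  shows "(\<integral>x. f ((T ^^ n) x) \<partial>M) = (\<integral>x. f x \<partial>M)"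
proof (induction n)
  case (Suc n)
  have "(\<integral>x. f ((T ^^ Suc n) x) \<partial>M) = (\<integral>x. (\<lambda>x. f ((T ^^ n) x)) (T x) \<partial>M)"
    by (simp add: funpow_swap1)
  also have "\<dots> = (\<integral>x. f ((T ^^ n) x) \<partial>M)" by (rule integral_T) simp
  finally show ?case using Suc by simp
qed simp

lemma integrable_running_max:
  assumes "integrable M f"
  shows "integrable M (running_max T f n)"
proof (induction n)
  case 0
  then show ?case by (simp add: running_max.simps(1)[abs_def])
next
  case (Suc n)
  have "integrable M (\<lambda>x. max 0 (f x + running_max T f n (T x)))"
    using assms integrable_T[OF Suc] by (intro integrable_max) auto
  then show ?case by (simp add: running_max.simps(2)[abs_def])
qed

text \<open>
  Garsia's argument: where the running maximum \<open>R\<close> is positive, \<open>f\<close> is at least \<open>R - R \<circ> T\<close>, and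
  elsewhere \<open>R - R \<circ> T \<le> 0\<close>; but the integral of \<open>R - R \<circ> T\<close> vanishes.
\<close>

lemma maximal_ergodic:
  assumes f: "integrable M f"
  shows "0 \<le> (\<integral>x. f x * indicator {x. 0 < running_max T f n x} x \<partial>M)"
proof (cases n)
  case (Suc k)
  let ?R = "running_max T f n"
  have R: "integrable M ?R" and fm [measurable]: "f \<in> borel_measurable M"
    using integrable_running_max[OF f] f by auto
  then have Rm [measurable]: "?R \<in> borel_measurable M" by auto
  have "0 = (\<integral>x. ?R x - ?R (T x) \<partial>M)"
    using R integrable_T[OF R] by (simp add: integral_T)
  also have "\<dots> \<le> (\<integral>x. f x * indicator {x. 0 < ?R x} x \<partial>M)"
  proof (rule integral_mono)
    show "integrable M (\<lambda>x. ?R x - ?R (T x))" using R integrable_T[OF R] by simp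
    have "integrable M (\<lambda>x. f x * indicator {x \<in> space M. 0 < ?R x} x)"
      using f by (rule integrable_real_mult_indicator[rotated]) measurable
    then show "integrable M (\<lambda>x. f x * indicator {x. 0 < ?R x} x)"
      by (rule Bochner_Integration.integrable_cong[THEN iffD1, rotated -1]) (auto simp: indicator_def)
    fix x
    show "?R x - ?R (T x) \<le> f x * indicator {x. 0 < ?R x} x"
    proof (cases "0 < ?R x")
      case True
      then have "?R x = f x + running_max T f k (T x)" using Suc by (simp add: max_def split: if_splits)
      then show ?thesis using True running_max_mono[of T f k "T x"] Suc by simp
    next
      case False
      then show ?thesis using running_max_nonneg[of T f n "T x"] by simp
    qed
  qed
  finally show ?thesis .
qed simp

lemma maximal_inequality:
  assumes f: "integrable M f" and l: "0 < l"
  shows "measure M {x \<in> space M. \<exists>n. l * real n < birkhoff_sum T f n x} \<le> (\<integral>x. \<bar>f x\<bar> \<partial>M) / l"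
proof -
  \<comment> \<open>A sum of \<open>n\<close> terms exceeds \<open>l * n\<close> exactly when the sum of the terms reduced by \<open>l\<close> is positive.\<close>
  define R where "R n = running_max T (\<lambda>x. f x - l) n" for n
  have g: "integrable M (\<lambda>x. f x - l)" using f by simp
  have [measurable]: "R n \<in> borel_measurable M" for n
    unfolding R_def using integrable_running_max[OF g] by auto
  have fm [measurable]: "f \<in> borel_measurable M" using f by auto
  define E where "E n = {x \<in> space M. 0 < R n x}" for n
  have Em [measurable]: "E n \<in> sets M" for n unfolding E_def by measurable
  have fi: "integrable M (\<lambda>x. f x * indicator (E n) x)" for n
    using f Em by (rule integrable_real_mult_indicator[rotated])
  have E: "measure M (E n) \<le> (\<integral>x. \<bar>f x\<bar> \<partial>M) / l" for n
  proof -
    have "0 \<le> (\<integral>x. (f x - l) * indicator {x. 0 < R n x} x \<partial>M)"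
      unfolding R_def by (rule maximal_ergodic[OF g])
    also have "\<dots> = (\<integral>x. f x * indicator (E n) x - l * indicator (E n) x \<partial>M)"
      by (rule Bochner_Integration.integral_cong) (auto simp: E_def indicator_def)
    also have "\<dots> = (\<integral>x. f x * indicator (E n) x \<partial>M) - l * measure M (E n)"
      using fi by (subst Bochner_Integration.integral_diff) (auto simp: emeasure_eq_measure)
    finally have "l * measure M (E n) \<le> (\<integral>x. f x * indicator (E n) x \<partial>M)" by simp
    also have "\<dots> \<le> (\<integral>x. \<bar>f x\<bar> \<partial>M)"
      using f fi by (intro integral_mono) (auto simp: indicator_def)
    finally show ?thesis using l by (simp add: field_simps)
  qed
  have "incseq E"
    unfolding R_def E_def
    by (intro incseq_SucI) (auto intro: less_le_trans[OF _ running_max_mono] simp del: running_max.simps)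
  then have "(\<lambda>n. measure M (E n)) \<longlonglongrightarrow> measure M (\<Union>n. E n)"
    by (intro finite_Lim_measure_incseq) auto
  then have U: "measure M (\<Union>n. E n) \<le> (\<integral>x. \<bar>f x\<bar> \<partial>M) / l"
    by (rule LIMSEQ_le_const2) (use E in auto)
  have "{x \<in> space M. \<exists>n. l * real n < birkhoff_sum T f n x} \<subseteq> (\<Union>n. E n)"
  proof safe
    fix x n assume x: "x \<in> space M" and n: "l * real n < birkhoff_sum T f n x"
    have "birkhoff_sum T (\<lambda>x. f x - l) n x = birkhoff_sum T f n x - l * real n"
      by (simp add: birkhoff_sum_def sum_subtractf)
    then have "0 < R n x"
      unfolding R_def using n birkhoff_sum_le_running_max[of n n T "\<lambda>x. f x - l" x] by linarith
    then show "x \<in> (\<Union>n. E n)" using x by (auto simp: E_def)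
  qed
  then have "measure M {x \<in> space M. \<exists>n. l * real n < birkhoff_sum T f n x} \<le> measure M (\<Union>n. E n)"
    by (intro finite_measure_mono) auto
  then show ?thesis using U by linarith
qed

text \<open>
  By the maximal inequality, the averages of \<open>\<bar>F - f m\<bar>\<close> are uniformly small outside a set whose
  measure tends to \<open>0\<close> with \<open>m\<close>. So almost every point has, for each accuracy, some \<open>m\<close> for which the
  averages of \<open>F\<close> and \<open>f m\<close> stay close for ever.
\<close>

lemma AE_average_tendsto_L1_limit:
  assumes F: "integrable M F" and f: "\<And>m. integrable M (f m)"
    and L1: "(\<lambda>m. \<integral>x. \<bar>F x - f m x\<bar> \<partial>M) \<longlonglongrightarrow> 0"
    and avg: "\<And>m. AE x in M. (\<lambda>n. birkhoff_sum T (f m) n x / n) \<longlonglongrightarrow> (\<integral>x. f m x \<partial>M)"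
  shows "AE x in M. (\<lambda>n. birkhoff_sum T F n x / n) \<longlonglongrightarrow> (\<integral>x. F x \<partial>M)"
proof -
  have [measurable]: "F \<in> borel_measurable M" "f m \<in> borel_measurable M" for m
    using F f by auto
  define D where "D m x = \<bar>F x - f m x\<bar>" for m x
  have Dm [measurable]: "D m \<in> borel_measurable M" for m unfolding D_def by measurable
  have Di: "integrable M (D m)" for m unfolding D_def using F f by auto
  have Dabs: "(\<integral>x. \<bar>D m x\<bar> \<partial>M) = (\<integral>x. D m x \<partial>M)" for m by (simp add: D_def)
  have D0: "(\<lambda>m. \<integral>x. D m x \<partial>M) \<longlonglongrightarrow> 0" using L1 by (simp add: D_def)
  define B where "B l m = {x \<in> space M. \<exists>n. l * real n < birkhoff_sum T (D m) n x}" for l m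
  have Bm [measurable]: "B l m \<in> sets M" for l m
    unfolding B_def birkhoff_sum_def by measurable
  have ae: "AE x in M. \<exists>m. (\<integral>x. D m x \<partial>M) < l \<and> x \<notin> B l m" if l: "0 < l" for l
  proof -
    let ?G = "{m. (\<integral>x. D m x \<partial>M) < l}"
    have "\<exists>m. m \<in> ?G \<and> measure M (B l m) < e" if e: "0 < e" for e
    proof -
      have "\<forall>\<^sub>F m in sequentially. (\<integral>x. D m x \<partial>M) < min l (e * l)"
        using D0 l e by (intro order_tendstoD) auto
      then obtain m where m: "(\<integral>x. D m x \<partial>M) < min l (e * l)"
        by (metis eventually_happens trivial_limit_sequentially)
      have "measure M (B l m) \<le> (\<integral>x. D m x \<partial>M) / l"
        using maximal_inequality[OF Di l, of m] by (simp add: B_def Dabs)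
      also have "\<dots> < e" using m l by (simp add: divide_less_eq)
      finally show ?thesis using m by auto
    qed
    then have small: "measure M (\<Inter>m\<in>?G. B l m) < e" if "0 < e" for e
      using that finite_measure_mono[of "\<Inter>m\<in>?G. B l m" "B l _"] by (metis (no_types, lifting) Bm INT_lower le_less_trans)
    have ne: "?G \<noteq> {}" using \<open>\<And>e. 0 < e \<Longrightarrow> \<exists>m. m \<in> ?G \<and> measure M (B l m) < e\<close>[of 1] by auto
    have sI: "(\<Inter>m\<in>?G. B l m) \<in> sets M" using ne by (intro sets.countable_INT') auto
    have "\<not> 0 < measure M (\<Inter>m\<in>?G. B l m)"
    proof
      assume "0 < measure M (\<Inter>m\<in>?G. B l m)"
      from small[OF this] show False by simp
    qed
    then have "measure M (\<Inter>m\<in>?G. B l m) = 0" by (simp add: not_less measure_le_0_iff)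
    then have "(\<Inter>m\<in>?G. B l m) \<in> null_sets M" using sI by (simp add: null_sets_def emeasure_eq_measure)
    then show ?thesis by (rule AE_I') auto
  qed
  have "AE x in M. \<forall>k::nat. \<exists>m. (\<integral>x. D m x \<partial>M) < 1 / Suc k \<and> x \<notin> B (1 / Suc k) m"
    unfolding AE_all_countable by (intro allI ae) simp
  moreover have "AE x in M. \<forall>m. (\<lambda>n. birkhoff_sum T (f m) n x / n) \<longlonglongrightarrow> (\<integral>x. f m x \<partial>M)"
    unfolding AE_all_countable using avg by auto
  ultimately show ?thesis using AE_space
  proof eventually_elim
    case (elim x)
    show ?case
    proof (rule LIMSEQ_I)
      fix r :: real assume "0 < r"
      then obtain k :: nat where k: "1 / Suc k < r / 3"
        using nat_approx_posE[of "r / 3"] by (auto simp del: of_nat_Suc)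
      obtain m where m: "(\<integral>x. D m x \<partial>M) < 1 / Suc k" "x \<notin> B (1 / Suc k) m" using elim by blast
      have i: "\<bar>(\<integral>x. F x \<partial>M) - (\<integral>x. f m x \<partial>M)\<bar> < r / 3"
      proof -
        have "(\<integral>x. F x \<partial>M) - (\<integral>x. f m x \<partial>M) = (\<integral>x. F x - f m x \<partial>M)" using F f by simp
        then have "\<bar>(\<integral>x. F x \<partial>M) - (\<integral>x. f m x \<partial>M)\<bar> \<le> (\<integral>x. D m x \<partial>M)"
          unfolding D_def using integral_abs_bound by metis
        then show ?thesis using m k by linarith
      qed
      from elim obtain N where N: "\<And>n. n \<ge> N \<Longrightarrow> \<bar>birkhoff_sum T (f m) n x / n - (\<integral>x. f m x \<partial>M)\<bar> < r / 3"
        using LIMSEQ_D[of "\<lambda>n. birkhoff_sum T (f m) n x / n" "\<integral>x. f m x \<partial>M" "r / 3"] \<open>0 < r\<close> by auto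
      have close: "\<bar>birkhoff_sum T F n x / n - birkhoff_sum T (f m) n x / n\<bar> \<le> r / 3" for n
      proof -
        have "\<bar>birkhoff_sum T F n x - birkhoff_sum T (f m) n x\<bar> \<le> birkhoff_sum T (D m) n x"
          unfolding birkhoff_sum_def D_def sum_subtractf[symmetric] by (rule sum_abs)
        also have "\<dots> \<le> 1 / Suc k * real n" using m(2) elim by (auto simp: B_def not_less)
        also have "\<dots> \<le> r / 3 * real n" using k by (intro mult_right_mono) auto
        finally have "\<bar>birkhoff_sum T F n x - birkhoff_sum T (f m) n x\<bar> / real n \<le> r / 3"
          using \<open>0 < r\<close> by (cases "n = 0") (auto simp: divide_le_eq)
        then show ?thesis by (simp add: diff_divide_distrib[symmetric])
      qed
      have "\<bar>birkhoff_sum T F n x / n - (\<integral>x. F x \<partial>M)\<bar> < r" if "n \<ge> N" for n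
        using close[of n] N[OF that] i by linarith
      then show "\<exists>N. \<forall>n\<ge>N. norm (birkhoff_sum T F n x / n - (\<integral>x. F x \<partial>M)) < r" by auto
    qed
  qed
qed

end

text \<open>
  Consecutive squares have quotient tending to \<open>1\<close>, so monotonicity controls \<open>s\<close> between them.
\<close>

lemma average_tendsto_of_squares:
  fixes s :: "nat \<Rightarrow> real"
  assumes mono: "mono s" and s0: "0 \<le> s 0" and sq: "(\<lambda>k. s (k\<^sup>2) / real (k\<^sup>2)) \<longlonglongrightarrow> c"
  shows "(\<lambda>n. s n / real n) \<longlonglongrightarrow> c"
proof -
  have s: "0 \<le> s n" for n using monoD[OF mono, of 0 n] s0 by simp
  have fs: "filterlim floor_sqrt at_top at_top"
    unfolding filterlim_at_top
  proof
    fix Z :: nat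
    show "\<forall>\<^sub>F n in sequentially. Z \<le> floor_sqrt n"
      using eventually_ge_at_top[of "Z\<^sup>2"] by eventually_elim (simp add: le_floor_sqrt_iff)
  qed
  have a: "(\<lambda>k. real k / real (Suc k)) \<longlonglongrightarrow> 1" by (rule LIMSEQ_n_over_Suc_n)
  have b: "(\<lambda>k. real (Suc k) / real k) \<longlonglongrightarrow> 1" by (rule LIMSEQ_Suc_n_over_n)
  have L: "(\<lambda>k. s (k\<^sup>2) / real (k\<^sup>2) * (real k / real (Suc k))\<^sup>2) \<longlonglongrightarrow> c * 1\<^sup>2"
    by (intro tendsto_intros sq a)
  have U: "(\<lambda>k. s ((Suc k)\<^sup>2) / real ((Suc k)\<^sup>2) * (real (Suc k) / real k)\<^sup>2) \<longlonglongrightarrow> c * 1\<^sup>2"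
    by (intro tendsto_intros b LIMSEQ_Suc[OF sq])
  show ?thesis
  proof (rule tendsto_sandwich)
    show "(\<lambda>n. s ((floor_sqrt n)\<^sup>2) / real ((floor_sqrt n)\<^sup>2) * (real (floor_sqrt n) / real (Suc (floor_sqrt n)))\<^sup>2) \<longlonglongrightarrow> c"
      using filterlim_compose[OF L fs] by simp
    show "(\<lambda>n. s ((Suc (floor_sqrt n))\<^sup>2) / real ((Suc (floor_sqrt n))\<^sup>2) * (real (Suc (floor_sqrt n)) / real (floor_sqrt n))\<^sup>2) \<longlonglongrightarrow> c"
      using filterlim_compose[OF U fs] by simp
    show "\<forall>\<^sub>F n in sequentially. s ((floor_sqrt n)\<^sup>2) / real ((floor_sqrt n)\<^sup>2) * (real (floor_sqrt n) / real (Suc (floor_sqrt n)))\<^sup>2 \<le> s n / real n"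
      using eventually_gt_at_top[of 0]
    proof eventually_elim
      case (elim n)
      define k where "k = floor_sqrt n"
      have k: "0 < k" "k\<^sup>2 \<le> n" "n \<le> (Suc k)\<^sup>2"
        using elim floor_sqrt_power2_le[of n] Suc_floor_sqrt_power2_gt[of n] by (auto simp: k_def)
      have "s (k\<^sup>2) / real ((Suc k)\<^sup>2) \<le> s n / real n"
        using k elim s monoD[OF mono k(2)] by (intro frac_le) (auto simp del: of_nat_power of_nat_Suc)
      then show ?case using k(1) by (simp add: k_def[symmetric] power_divide field_simps del: of_nat_Suc)
    qed
    show "\<forall>\<^sub>F n in sequentially. s n / real n \<le> s ((Suc (floor_sqrt n))\<^sup>2) / real ((Suc (floor_sqrt n))\<^sup>2) * (real (Suc (floor_sqrt n)) / real (floor_sqrt n))\<^sup>2"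
      using eventually_gt_at_top[of 0]
    proof eventually_elim
      case (elim n)
      define k where "k = floor_sqrt n"
      have k: "0 < k" "k\<^sup>2 \<le> n" "n \<le> (Suc k)\<^sup>2"
        using elim floor_sqrt_power2_le[of n] Suc_floor_sqrt_power2_gt[of n] by (auto simp: k_def)
      have "s n / real n \<le> s ((Suc k)\<^sup>2) / real (k\<^sup>2)"
        using k elim s monoD[OF mono k(3)] by (intro frac_le) (auto simp del: of_nat_power of_nat_Suc)
      then show ?case using k(1) by (simp add: k_def[symmetric] power_divide field_simps del: of_nat_Suc)
    qed
  qed
qed

context measure_preserving
begin

text \<open>
  Only the pairs with \<open>\<bar>i - j\<bar> < m\<close> contribute to the variance, which is therefore linear in the number
  of terms. The mean square deviations of the averages over \<open>k\<^sup>2\<close> terms are then summable in \<open>k\<close>.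
\<close>

lemma AE_average_tendsto_finite_range:
  assumes fm [measurable]: "f \<in> borel_measurable M"
    and f: "\<And>x. 0 \<le> f x" "\<And>x. f x \<le> B"
    and uncorrelated: "\<And>n. m \<le> n \<Longrightarrow> (\<integral>x. f x * f ((T ^^ n) x) \<partial>M) = (\<integral>x. f x \<partial>M)\<^sup>2"
  shows "AE x in M. (\<lambda>n. birkhoff_sum T f n x / n) \<longlonglongrightarrow> (\<integral>x. f x \<partial>M)"
proof -
  define c where "c = (\<integral>x. f x \<partial>M)"
  have B: "0 \<le> B" using f[of undefined] by linarith
  have bint: "integrable M g" if "g \<in> borel_measurable M" "\<And>x. \<bar>g x\<bar> \<le> K" for g :: "'a \<Rightarrow> real" and K
    using that by (intro integrable_const_bound[where B = K]) auto
  have fb: "\<bar>f x\<bar> \<le> B" "\<bar>f x * f y\<bar> \<le> B\<^sup>2" for x y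
    using f mult_mono[OF f(2)[of x] f(2)[of y] B f(1)[of y]] by (auto simp: power2_eq_square)
  have fi: "integrable M (\<lambda>x. f ((T ^^ i) x))" "integrable M (\<lambda>x. f ((T ^^ i) x) * f ((T ^^ j) x))" for i j
    by (rule bint[of _ B], measurable, rule fb, rule bint[of _ "B\<^sup>2"], measurable, rule fb)
  have Ei: "(\<integral>x. f ((T ^^ i) x) \<partial>M) = c" for i unfolding c_def by (rule integral_funpow) simp
  have corr: "(\<integral>x. f ((T ^^ i) x) * f ((T ^^ j) x) \<partial>M) = (\<integral>x. f x * f ((T ^^ (j - i)) x) \<partial>M)"
    if "i \<le> j" for i j
  proof -
    have "(T ^^ j) x = (T ^^ (j - i)) ((T ^^ i) x)" for x
      using that by (metis comp_apply funpow_add le_add_diff_inverse2)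
    then show ?thesis using integral_funpow[of "\<lambda>x. f x * f ((T ^^ (j - i)) x)" i] by simp
  qed
  define C where "C i j = (\<integral>x. (f ((T ^^ i) x) - c) * (f ((T ^^ j) x) - c) \<partial>M)" for i j
  have C_eq: "C i j = (\<integral>x. f ((T ^^ i) x) * f ((T ^^ j) x) \<partial>M) - c\<^sup>2" for i j
  proof -
    have "C i j = (\<integral>x. f ((T ^^ i) x) * f ((T ^^ j) x) - c * f ((T ^^ i) x) - c * f ((T ^^ j) x) + c\<^sup>2 \<partial>M)"
      unfolding C_def by (intro Bochner_Integration.integral_cong) (auto simp: algebra_simps power2_eq_square)
    also have "\<dots> = (\<integral>x. f ((T ^^ i) x) * f ((T ^^ j) x) \<partial>M) - c * c - c * c + c\<^sup>2"
      using fi by (simp add: Ei prob_space)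
    finally show ?thesis by (simp add: power2_eq_square)
  qed
  have C_sym: "C i j = C j i" for i j unfolding C_def by (simp add: mult.commute)
  have C_zero: "C i j = 0" if "i + m \<le> j" for i j
    using that by (simp add: C_eq corr uncorrelated c_def)
  have C_le: "C i j \<le> B\<^sup>2" for i j
  proof -
    have "(\<integral>x. f ((T ^^ i) x) * f ((T ^^ j) x) \<partial>M) \<le> (\<integral>x. B\<^sup>2 \<partial>M)"
      using fi by (intro integral_mono abs_le_D1[OF fb(2)]) auto
    then show ?thesis by (simp add: C_eq prob_space) (use zero_le_power2[of c] in linarith)
  qed
  have var: "(\<integral>x. (birkhoff_sum T f n x - n * c)\<^sup>2 \<partial>M) \<le> real n * (2 * real m * B\<^sup>2)" for n
  proof -
    have ci: "integrable M (\<lambda>x. (f ((T ^^ i) x) - c) * (f ((T ^^ j) x) - c))" for i j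
    proof -
      have "(f x - c) * (f y - c) = f x * f y - c * f x - c * f y + c\<^sup>2" for x y
        by (simp add: algebra_simps power2_eq_square)
      then show ?thesis using fi by simp
    qed
    have "(birkhoff_sum T f n x - n * c)\<^sup>2 = (\<Sum>i<n. \<Sum>j<n. (f ((T ^^ i) x) - c) * (f ((T ^^ j) x) - c))" for x
      unfolding sum_product[symmetric] birkhoff_sum_def by (simp add: sum_subtractf power2_eq_square)
    then have "(\<integral>x. (birkhoff_sum T f n x - n * c)\<^sup>2 \<partial>M) = (\<Sum>i<n. \<Sum>j<n. C i j)"
      unfolding C_def using ci by (simp add: Bochner_Integration.integral_sum Bochner_Integration.integrable_sum)
    also have "\<dots> \<le> (\<Sum>i<n. 2 * real m * B\<^sup>2)"
    proof (rule sum_mono)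
      fix i
      have "(\<Sum>j<n. C i j) \<le> (\<Sum>j<n. if j \<in> {i - m..<i + m} then B\<^sup>2 else 0)"
      proof (rule sum_mono)
        fix j
        show "C i j \<le> (if j \<in> {i - m..<i + m} then B\<^sup>2 else 0)"
          using C_le[of i j] C_zero[of i j] C_zero[of j i] C_sym[of i j] by auto
      qed
      also have "\<dots> = real (card ({..<n} \<inter> {i - m..<i + m})) * B\<^sup>2"
        by (subst sum.inter_restrict[symmetric]) auto
      also have "\<dots> \<le> (2 * real m) * B\<^sup>2"
      proof (rule mult_right_mono)
        have "card ({..<n} \<inter> {i - m..<i + m}) \<le> card {i - m..<i + m}" by (intro card_mono) auto
        then show "real (card ({..<n} \<inter> {i - m..<i + m})) \<le> 2 * real m" by simp
      qed simp
      finally show "(\<Sum>j<n. C i j) \<le> 2 * real m * B\<^sup>2" by simp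
    qed
    finally show ?thesis by simp
  qed
  define X where "X k x = (birkhoff_sum T f ((Suc k)\<^sup>2) x / real ((Suc k)\<^sup>2) - c)\<^sup>2" for k x
  have Xm [measurable]: "X k \<in> borel_measurable M" for k unfolding X_def birkhoff_sum_def by measurable
  have S_bound: "\<bar>birkhoff_sum T f n x - n * c\<bar> \<le> n * (B + \<bar>c\<bar>)" for n x
  proof -
    have "\<bar>birkhoff_sum T f n x - n * c\<bar> = \<bar>\<Sum>i<n. f ((T ^^ i) x) - c\<bar>"
      by (simp add: birkhoff_sum_def sum_subtractf)
    also have "\<dots> \<le> (\<Sum>i<n. \<bar>f ((T ^^ i) x) - c\<bar>)" by (rule sum_abs)
    also have "\<dots> \<le> (\<Sum>i<n. B + \<bar>c\<bar>)"
    proof (rule sum_mono)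
      show "\<bar>f ((T ^^ i) x) - c\<bar> \<le> B + \<bar>c\<bar>" for i using fb(1)[of "(T ^^ i) x"] by linarith
    qed
    finally show ?thesis by simp
  qed
  have X_int: "(\<integral>\<^sup>+x. ennreal (X k x) \<partial>M) \<le> ennreal (2 * real m * B\<^sup>2 * (1 / (Suc k)\<^sup>2))" for k
  proof -
    let ?n = "(Suc k)\<^sup>2"
    have Xe: "X k x = (birkhoff_sum T f ?n x - ?n * c)\<^sup>2 / (real ?n)\<^sup>2" for x
      unfolding X_def by (simp add: power_divide[symmetric] diff_divide_distrib del: of_nat_power)
    have sqi: "integrable M (\<lambda>x. (birkhoff_sum T f ?n x - ?n * c)\<^sup>2)"
    proof (rule bint)
      show "\<bar>(birkhoff_sum T f ?n x - ?n * c)\<^sup>2\<bar> \<le> (?n * (B + \<bar>c\<bar>))\<^sup>2" for x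
        using power_mono[OF S_bound[of ?n x], of 2] by (simp del: of_nat_power)
    qed (simp add: birkhoff_sum_def)
    have "(\<integral>\<^sup>+x. ennreal (X k x) \<partial>M) = ennreal (\<integral>x. X k x \<partial>M)"
      using sqi by (intro nn_integral_eq_integral) (auto simp: Xe[abs_def])
    also have "(\<integral>x. X k x \<partial>M) \<le> real ?n * (2 * real m * B\<^sup>2) / (real ?n)\<^sup>2"
      unfolding Xe using divide_right_mono[OF var[of ?n], of "(real ?n)\<^sup>2"] by simp
    also have "real ?n * (2 * real m * B\<^sup>2) / (real ?n)\<^sup>2 = 2 * real m * B\<^sup>2 * (1 / (Suc k)\<^sup>2)"
    proof -
      have "q * b / q\<^sup>2 = b * (1 / q)" for q b :: real by (simp add: power2_eq_square)
      then show ?thesis by blast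
    qed
    finally show ?thesis by (simp add: ennreal_leI)
  qed
  have summ: "summable (\<lambda>k. 2 * real m * B\<^sup>2 * (1 / real ((Suc k)\<^sup>2)))"
    using inverse_squares_sums by (intro summable_mult) (auto simp: sums_iff)
  have "(\<integral>\<^sup>+x. (\<Sum>k. ennreal (X k x)) \<partial>M) = (\<Sum>k. \<integral>\<^sup>+x. ennreal (X k x) \<partial>M)"
    by (rule nn_integral_suminf) simp
  also have "\<dots> \<le> (\<Sum>k. ennreal (2 * real m * B\<^sup>2 * (1 / (Suc k)\<^sup>2)))"
    by (intro suminf_le X_int) auto
  also have "\<dots> < \<infinity>"
    using summ by (subst suminf_ennreal_eq[OF _ summable_sums]) auto
  finally have "AE x in M. (\<Sum>k. ennreal (X k x)) \<noteq> \<infinity>"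
    by (intro nn_integral_noteq_infinite) auto
  then show ?thesis
  proof eventually_elim
    case (elim x)
    have "summable (\<lambda>k. X k x)"
      using elim by (intro summable_suminf_not_top) (auto simp: X_def)
    then have "(\<lambda>k. X k x) \<longlonglongrightarrow> 0" by (rule summable_LIMSEQ_zero)
    then have "(\<lambda>k. sqrt (X k x)) \<longlonglongrightarrow> sqrt 0" by (rule tendsto_real_sqrt)
    then have "(\<lambda>k. \<bar>birkhoff_sum T f ((Suc k)\<^sup>2) x / real ((Suc k)\<^sup>2) - c\<bar>) \<longlonglongrightarrow> 0"
      by (simp add: X_def)
    then have "(\<lambda>k. birkhoff_sum T f ((Suc k)\<^sup>2) x / real ((Suc k)\<^sup>2)) \<longlonglongrightarrow> c"
      by (simp add: tendsto_rabs_zero_iff LIM_zero_iff)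
    then have "(\<lambda>k. birkhoff_sum T f (k\<^sup>2) x / real (k\<^sup>2)) \<longlonglongrightarrow> c"
      by (rule LIMSEQ_imp_Suc)
    then show ?case
      unfolding c_def[symmetric]
      by (intro average_tendsto_of_squares incseq_SucI) (auto simp: birkhoff_sum_def f)
  qed
qed

end

section \<open>The Bernoulli environment\<close>

definition bernoulli_env :: "real \<Rightarrow> (int \<Rightarrow> bool) measure" where
  "bernoulli_env p = PiM UNIV (\<lambda>_. measure_pmf (bernoulli_pmf p))"

definition env_shift :: "(int \<Rightarrow> bool) \<Rightarrow> int \<Rightarrow> bool" where
  "env_shift b x = b (x + 1)"

lemma space_bernoulli_env [simp]: "space (bernoulli_env p) = UNIV"
  by (simp add: bernoulli_env_def space_PiM)

lemma measurable_bernoulli_env_component [measurable]: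
  "(\<lambda>b. b x) \<in> measurable (bernoulli_env p) (count_space UNIV)"
  unfolding bernoulli_env_def
  by (rule measurable_compose[OF measurable_component_singleton]) simp_all

interpretation bernoulli_env: measure_preserving "bernoulli_env p" env_shift for p
proof -
  interpret prob_space "bernoulli_env p"
    unfolding bernoulli_env_def by (intro prob_space_PiM measure_pmf.prob_space_axioms)
  show "measure_preserving (bernoulli_env p) env_shift"
  proof
    show "env_shift \<in> measurable (bernoulli_env p) (bernoulli_env p)"
      unfolding bernoulli_env_def env_shift_def[abs_def]
    proof (rule measurable_PiM_single')
      show "(\<lambda>b. b (x + 1)) \<in> measurable (PiM UNIV (\<lambda>_. measure_pmf (bernoulli_pmf p)))
          (measure_pmf (bernoulli_pmf p))" for x :: int
        by (rule measurable_component_singleton) simp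
    qed (auto simp: space_PiM)
    have "env_shift = (\<lambda>b. \<lambda>x\<in>UNIV. b (x + 1))" by (auto simp: env_shift_def fun_eq_iff)
    then show "distr (bernoulli_env p) (bernoulli_env p) env_shift = bernoulli_env p"
      unfolding bernoulli_env_def
      using distr_PiM_reindex[of UNIV "\<lambda>_. measure_pmf (bernoulli_pmf p)" "\<lambda>x :: int. x + 1" UNIV]
      by (simp add: measure_pmf.prob_space_axioms inj_on_def)
  qed
qed

lemma funpow_env_shift: "(env_shift ^^ n) b x = b (x + int n)"
  by (induction n arbitrary: x) (auto simp: env_shift_def algebra_simps)

lemma left_window_env_shift: "left_window ((env_shift ^^ n) b) m 0 = left_window b m (int n)"
  by (simp add: left_window_def funpow_env_shift)

lemma left_window_eq_iff:
  "left_window b n x = l \<longleftrightarrow> length l = n \<and> (\<forall>i<n. b (x - int i) = l ! i)"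
  unfolding left_window_def by (subst list_eq_iff_nth_eq) auto

lemma measurable_left_window [measurable]:
  "(\<lambda>b. left_window b n x) \<in> measurable (bernoulli_env p) (count_space UNIV)"
proof (subst measurable_count_space_eq2_countable, intro conjI ballI)
  fix l :: "bool list"
  have "(\<lambda>b. left_window b n x) -` {l} \<inter> space (bernoulli_env p) =
      {b \<in> space (bernoulli_env p). length l = n \<and> (\<forall>i<n. b (x - int i) = l ! i)}"
    unfolding vimage_def singleton_iff left_window_eq_iff by auto
  also have "\<dots> \<in> sets (bernoulli_env p)" by measurable
  finally show "(\<lambda>b. left_window b n x) -` {l} \<inter> space (bernoulli_env p) \<in> sets (bernoulli_env p)" .
qed auto

definition word_weight :: "real \<Rightarrow> bool list \<Rightarrow> real" where
  "word_weight p l = (\<Prod>b\<leftarrow>l. if b then p else 1 - p)"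

lemma word_weight_nonneg: "0 \<le> p \<Longrightarrow> p \<le> 1 \<Longrightarrow> 0 \<le> word_weight p l"
  unfolding word_weight_def by (rule prod_list_nonneg) auto

lemma finite_words: "finite {l :: bool list. length l = n}"
  using finite_lists_length_eq[of "UNIV :: bool set" n] by simp

lemma bernoulli_mean_eq_sum:
  "bernoulli_mean p n F = (\<Sum>l | length l = n. word_weight p l * F l)"
proof (induction n arbitrary: F)
  case 0
  have "{l :: bool list. length l = 0} = {[]}" by auto
  then show ?case by (simp add: word_weight_def)
next
  case (Suc n)
  let ?W = "{l :: bool list. length l = n}"
  have "{l :: bool list. length l = Suc n} = (#) True ` ?W \<union> (#) False ` ?W"
    by (auto simp: length_Suc_conv image_iff)
  then have "(\<Sum>l | length l = Suc n. word_weight p l * F l) =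
      (\<Sum>l\<in>(#) True ` ?W. word_weight p l * F l) + (\<Sum>l\<in>(#) False ` ?W. word_weight p l * F l)"
    by (simp only:) (rule sum.union_disjoint, auto simp: finite_words)
  also have "\<dots> = (\<Sum>l\<in>?W. p * (word_weight p l * F (True # l))) +
      (\<Sum>l\<in>?W. (1 - p) * (word_weight p l * F (False # l)))"
    by (subst (1 2) sum.reindex) (auto simp: word_weight_def mult.assoc)
  finally show ?case by (simp add: Suc sum_distrib_left)
qed

lemma prob_left_window_eq:
  assumes p: "0 \<le> p" "p \<le> 1" and l: "length l = n"
  shows "measure (bernoulli_env p) {b. left_window b n x = l} = word_weight p l"
proof -
  interpret product_prob_space "\<lambda>_ :: int. measure_pmf (bernoulli_pmf p)" UNIV
    by standard
  let ?J = "(\<lambda>i. x - int i) ` {..<n}"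
  have "{b. left_window b n x = l} = {b \<in> space (bernoulli_env p). \<forall>i\<in>?J. b i \<in> {l ! nat (x - i)}}"
    using l by (auto simp: left_window_eq_iff)
  then have "emeasure (bernoulli_env p) {b. left_window b n x = l} =
      (\<Prod>i\<in>?J. emeasure (measure_pmf (bernoulli_pmf p)) {l ! nat (x - i)})"
    unfolding bernoulli_env_def by (simp only:) (subst emeasure_PiM_Collect, auto)
  also have "\<dots> = (\<Prod>i<n. ennreal (if l ! i then p else 1 - p))"
    using p by (subst prod.reindex) (auto simp: inj_on_def emeasure_pmf_single intro!: prod.cong)
  also have "\<dots> = ennreal (\<Prod>i<n. if l ! i then p else 1 - p)"
    using p by (intro prod_ennreal) auto
  also have "(\<Prod>i<n. if l ! i then p else 1 - p) = word_weight p l"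
    unfolding word_weight_def using l
    by (subst prod.list_conv_set_nth) (auto simp: atLeast0LessThan)
  finally show ?thesis
    using word_weight_nonneg[OF p] by (simp add: measure_def)
qed

lemma integral_left_window:
  fixes F :: "bool list \<Rightarrow> real"
  assumes p: "0 \<le> p" "p \<le> 1"
  shows "integrable (bernoulli_env p) (\<lambda>b. F (left_window b n x))" (is ?I)
    and "(\<integral>b. F (left_window b n x) \<partial>bernoulli_env p) = bernoulli_mean p n F" (is ?E)
proof -
  let ?W = "{l :: bool list. length l = n}"
  have F: "F (left_window b n x) = (\<Sum>l\<in>?W. F l * indicator {b. left_window b n x = l} b)" for b
    by (subst sum.remove[of _ "left_window b n x"]) (auto simp: finite_words indicator_def)
  have S: "{b. left_window b n x = l} \<in> sets (bernoulli_env p)" for l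
  proof -
    have "{b \<in> space (bernoulli_env p). left_window b n x = l} \<in> sets (bernoulli_env p)" by measurable
    then show ?thesis by simp
  qed
  have i: "integrable (bernoulli_env p) (\<lambda>b. F l * indicator {b. left_window b n x = l} b)" for l
    using S by (intro integrable_mult_right) (simp add: bernoulli_env.emeasure_eq_measure)
  show ?I unfolding F by (intro Bochner_Integration.integrable_sum i)
  have "(\<integral>b. F (left_window b n x) \<partial>bernoulli_env p) =
      (\<Sum>l\<in>?W. F l * measure (bernoulli_env p) {b. left_window b n x = l})"
    unfolding F using i S by (subst Bochner_Integration.integral_sum) auto
  also have "\<dots> = bernoulli_mean p n F"
    unfolding bernoulli_mean_eq_sum using p by (intro sum.cong) (auto simp: prob_left_window_eq)
  finally show ?E .
qed

text \<open>Windows at distance at least \<open>m\<close> are disjoint pieces of one long window, hence independent.\<close>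

lemma AE_average_left_window:
  fixes F :: "bool list \<Rightarrow> real"
  assumes p: "0 \<le> p" "p \<le> 1" and F: "\<And>l. 0 \<le> F l"
  shows "AE b in bernoulli_env p. (\<lambda>n. birkhoff_sum env_shift (\<lambda>b. F (left_window b m 0)) n b / n)
    \<longlonglongrightarrow> (\<integral>b. F (left_window b m 0) \<partial>bernoulli_env p)"
proof (rule bernoulli_env.AE_average_tendsto_finite_range)
  show "F (left_window b m 0) \<le> (\<Sum>l | length l = m. F l)" for b
    by (rule member_le_sum) (auto simp: F finite_words)
  fix n assume n: "m \<le> n"
  have "left_window b n (int n) = left_window b m (int n) @ left_window b (n - m) (int n - int m)" for b :: "int \<Rightarrow> bool"
    using left_window_append[of b m "n - m" "int n"] n by simp
  moreover have "left_window b (n + m) (int n) = left_window b n (int n) @ left_window b m 0" for b :: "int \<Rightarrow> bool"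
    using left_window_append[of b n m "int n"] by simp
  ultimately have "left_window b m 0 = drop n (left_window b (n + m) (int n))"
      "left_window b m (int n) = take m (take n (left_window b (n + m) (int n)))" for b :: "int \<Rightarrow> bool"
    using n by (simp_all add: min_absorb1)
  then have "(\<integral>b. F (left_window b m 0) * F (left_window ((env_shift ^^ n) b) m 0) \<partial>bernoulli_env p) =
      (\<integral>b. (\<lambda>l. F (take m (take n l)) * F (drop n l)) (left_window b (n + m) (int n)) \<partial>bernoulli_env p)"
    unfolding left_window_env_shift by (simp add: mult.commute)
  also have "\<dots> = bernoulli_mean p n (\<lambda>l. F (take m l)) * bernoulli_mean p m F"
    using integral_left_window(2)[OF p, of "\<lambda>l. F (take m (take n l)) * F (drop n l)" "n + m" "int n"]
      bernoulli_mean_split[of p n m "\<lambda>l. F (take m l)" F] by simp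
  also have "bernoulli_mean p n (\<lambda>l. F (take m l)) = bernoulli_mean p m F"
    using bernoulli_mean_split[of p m "n - m" F "\<lambda>_. 1"] n by (simp add: bernoulli_mean_const)
  finally show "(\<integral>b. F (left_window b m 0) * F (left_window ((env_shift ^^ n) b) m 0) \<partial>bernoulli_env p) =
      (\<integral>b. F (left_window b m 0) \<partial>bernoulli_env p)\<^sup>2"
    by (simp add: integral_left_window(2)[OF p] power2_eq_square)
qed (auto simp: F)

section \<open>The quenched speed\<close>

lemma mean_window_time_tendsto:
  fixes r p :: real
  assumes r: "0 < r" "r < 1" and p: "0 < p" "p \<le> 1" and small: "p * wall_defect r < 1"
  obtains T where "(\<lambda>n. bernoulli_mean p n (window_time r)) \<longlonglongrightarrow> T"
    "\<And>n. bernoulli_mean p n (window_time r) \<le> T"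
    "mean_lower p \<le> T" "T \<le> (mean_lower p + 3 * wall_defect r) / (1 - p * wall_defect r)"
proof -
  let ?e = "\<lambda>n. bernoulli_mean p n (window_time r)"
  have inc: "incseq ?e"
  proof (rule incseq_SucI)
    fix n
    have "left_window b (Suc n) x = left_window b n x @ [b (x - int n)]" for b :: "int \<Rightarrow> bool" and x
      by (simp add: left_window_def)
    then have "window_time r (left_window b n 0) \<le> window_time r (left_window b (Suc n) 0)" for b :: "int \<Rightarrow> bool"
      using up_time_append_mono[OF survival_unit[OF r] survival_unit[OF r, of "[_]"]]
      by (simp add: window_time_def)
    then have "(\<integral>b. window_time r (left_window b n 0) \<partial>bernoulli_env p) \<le>
        (\<integral>b. window_time r (left_window b (Suc n) 0) \<partial>bernoulli_env p)"
      using p by (intro integral_mono integral_left_window) auto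
    then show "?e n \<le> ?e (Suc n)" using p by (simp add: integral_left_window del: bernoulli_mean.simps)
  qed
  have bd: "?e n \<le> (mean_lower p + 3 * wall_defect r) / (1 - p * wall_defect r)" for n
    using mean_window_time_le[OF r refl p small] .
  obtain T where T: "?e \<longlonglongrightarrow> T" "\<And>n. ?e n \<le> T"
    using incseq_convergent[OF inc] bd by blast
  have "(\<lambda>n. (1 - p) ^ n) \<longlonglongrightarrow> 0" using p by (intro LIMSEQ_realpow_zero) auto
  then have "(\<lambda>n. 1 + 2 / 3 * ((1 - p)\<^sup>2 * (1 - (1 - p) ^ n) / p)) \<longlonglongrightarrow> 1 + 2 / 3 * ((1 - p)\<^sup>2 * (1 - 0) / p)"
    using p by (intro tendsto_intros) auto
  then have "mean_lower p \<le> T"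
    using p mean_window_time_ge[OF r p]
    by (intro LIMSEQ_le[OF _ LIMSEQ_Suc[OF T(1)]]) (auto simp: mean_lower_eq simp del: bernoulli_mean.simps)
  moreover have "T \<le> (mean_lower p + 3 * wall_defect r) / (1 - p * wall_defect r)"
    by (rule LIMSEQ_le_const2[OF T(1)]) (use bd in auto)
  ultimately show thesis using that T by blast
qed

text \<open>
  The means with a wall increase to \<open>T\<close>. By monotone convergence the limit of the times is almost surely
  finite, and it is approximated in mean by functions of finitely many sites.
\<close>

lemma AE_average_passage_time:
  fixes r p T :: real
  assumes r: "0 < r" "r < 1" and p: "0 < p" "p \<le> 1"
    and T: "(\<lambda>n. bernoulli_mean p n (window_time r)) \<longlonglongrightarrow> T" "\<And>n. bernoulli_mean p n (window_time r) \<le> T"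
  shows "AE b in bernoulli_env p. \<exists>t.
    (\<forall>x. (\<lambda>m. window_time r (left_window b m x)) \<longlonglongrightarrow> t x) \<and>
    (\<lambda>y. (\<Sum>x<y. t (int x)) / real y) \<longlonglongrightarrow> T"
proof -
  let ?E = "bernoulli_env p"
  let ?f = "\<lambda>m b. window_time r (left_window b m 0)"
  have p': "0 \<le> p" using p by simp
  have nn: "0 \<le> window_time r l" for l using window_time_nonneg[OF r] .
  have inc: "incseq (\<lambda>m. window_time r (left_window b m x))" for b x
  proof (rule incseq_SucI)
    fix n
    have "left_window b (Suc n) x = left_window b n x @ [b (x - int n)]" by (simp add: left_window_def)
    then show "window_time r (left_window b n x) \<le> window_time r (left_window b (Suc n) x)"
      using up_time_append_mono[OF survival_unit[OF r] survival_unit[OF r, of "[_]"]]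
      by (simp add: window_time_def)
  qed
  have bounded: "AE b in ?E. \<exists>B. \<forall>m. window_time r (left_window b m x) \<le> B" for x
  proof -
    have "(\<integral>\<^sup>+b. (SUP m. ennreal (window_time r (left_window b m x))) \<partial>?E) =
        (SUP m. \<integral>\<^sup>+b. ennreal (window_time r (left_window b m x)) \<partial>?E)"
      using inc by (intro nn_integral_monotone_convergence_SUP) (auto simp: incseq_def le_fun_def intro!: ennreal_leI)
    also have "\<dots> = (SUP m. ennreal (bernoulli_mean p m (window_time r)))"
      using nn integral_left_window[OF p' p(2), of "window_time r"] by (simp add: nn_integral_eq_integral)
    also have "\<dots> \<le> ennreal T" using T(2) by (intro SUP_least ennreal_leI) auto
    finally have "(\<integral>\<^sup>+b. (SUP m. ennreal (window_time r (left_window b m x))) \<partial>?E) \<noteq> \<infinity>"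
      using ennreal_less_top[of T] by (auto simp: top_unique)
    then have "AE b in ?E. (SUP m. ennreal (window_time r (left_window b m x))) \<noteq> \<infinity>"
      by (intro nn_integral_noteq_infinite) auto
    then show ?thesis
    proof eventually_elim
      case (elim b)
      then obtain B where B: "(SUP m. ennreal (window_time r (left_window b m x))) = ennreal B" "0 \<le> B"
        by (cases "SUP m. ennreal (window_time r (left_window b m x))") auto
      have "ennreal (window_time r (left_window b m x)) \<le> ennreal B" for m
        unfolding B(1)[symmetric] by (intro SUP_upper) auto
      then show ?case using B(2) by (auto simp: ennreal_le_iff)
    qed
  qed
  define t where "t b x = lim (\<lambda>m. window_time r (left_window b m x))" for b x
  have t: "AE b in ?E. \<forall>x. (\<lambda>m. window_time r (left_window b m x)) \<longlonglongrightarrow> t b x"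
    unfolding AE_all_countable
  proof
    fix x
    from bounded[of x] show "AE b in ?E. (\<lambda>m. window_time r (left_window b m x)) \<longlonglongrightarrow> t b x"
    proof eventually_elim
      case (elim b)
      then obtain L where "(\<lambda>m. window_time r (left_window b m x)) \<longlonglongrightarrow> L"
        using incseq_convergent[OF inc] by blast
      then show ?case by (simp add: t_def limI)
    qed
  qed
  have t_shift: "t ((env_shift ^^ n) b) 0 = t b (int n)" for n b
    by (simp add: t_def left_window_env_shift)
  let ?F = "\<lambda>b. t b 0"
  have Fm [measurable]: "?F \<in> borel_measurable ?E"
    unfolding t_def by (intro borel_measurable_lim_metric) measurable
  have fi: "integrable ?E (?f m)" and fE: "(\<integral>b. ?f m b \<partial>?E) = bernoulli_mean p m (window_time r)" for m
    using integral_left_window[OF p' p(2)] by auto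
  have t0: "AE b in ?E. (\<lambda>m. ?f m b) \<longlonglongrightarrow> ?F b" using t by (rule AE_mp) auto
  have "has_bochner_integral ?E ?F T"
    by (rule has_bochner_integral_monotone_convergence[OF fi _ t0]) (use inc T in \<open>auto simp: incseq_def mono_def fE\<close>)
  then have F: "integrable ?E ?F" "(\<integral>b. ?F b \<partial>?E) = T" by (auto simp: has_bochner_integral_iff)
  have "(\<lambda>m. \<integral>b. \<bar>?F b - ?f m b\<bar> \<partial>?E) \<longlonglongrightarrow> 0"
  proof -
    have "(\<integral>b. \<bar>?F b - ?f m b\<bar> \<partial>?E) = T - bernoulli_mean p m (window_time r)" for m
    proof -
      have "AE b in ?E. \<bar>?F b - ?f m b\<bar> = ?F b - ?f m b"
        using t0 by eventually_elim (use incseq_le[OF inc] in auto)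
      then have "(\<integral>b. \<bar>?F b - ?f m b\<bar> \<partial>?E) = (\<integral>b. ?F b - ?f m b \<partial>?E)"
        by (intro integral_cong_AE) auto
      then show ?thesis using F fi fE by simp
    qed
    then show ?thesis using tendsto_diff[OF tendsto_const[of T] T(1)] by simp
  qed
  then have "AE b in ?E. (\<lambda>n. birkhoff_sum env_shift ?F n b / n) \<longlonglongrightarrow> (\<integral>b. ?F b \<partial>?E)"
    by (rule bernoulli_env.AE_average_tendsto_L1_limit[where f = ?f, OF F(1) fi _
          AE_average_left_window[OF p' p(2) nn]])
  with t show ?thesis
    by eventually_elim (auto simp: birkhoff_sum_def t_shift F(2))
qed

text \<open>
  Almost surely the potential is determined by the set of obstacles, so that almost sure statements can be
  proved for the law of this set, which, unlike the underlying probability space, has a shift.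
\<close>

lemma (in bernoulli_potential) distr_obstacles:
  assumes "M \<noteq> 0"
  shows "(\<lambda>\<omega> x. V x \<omega> = M) \<in> measurable P (bernoulli_env p)"
    and "distr P (bernoulli_env p) (\<lambda>\<omega> x. V x \<omega> = M) = bernoulli_env p"
    and "AE \<omega> in P. \<forall>x. V x \<omega> = (if V x \<omega> = M then M else 0)"
proof -
  have rv [measurable]: "V x \<in> borel_measurable P" for x
    using indep by (auto simp: indep_vars_def)
  have p: "0 \<le> p" "p \<le> 1" using prob_M[of 0] by (auto simp: measure_nonneg prob_le_1)
  let ?B = "\<lambda>_ :: int. count_space UNIV :: bool measure"
  have iv: "indep_vars ?B (\<lambda>x \<omega>. V x \<omega> = M) UNIV"
    by (rule indep_vars_compose2[OF indep]) auto
  have one: "distr P (count_space UNIV) (\<lambda>\<omega>. V x \<omega> = M) = measure_pmf (bernoulli_pmf p)" for x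
  proof (rule measure_eqI_countable[where A = UNIV])
    fix b :: bool
    have f: "prob {\<omega> \<in> space P. V x \<omega> \<noteq> M} = 1 - p"
      using prob_neg[of "\<lambda>\<omega>. V x \<omega> = M"] prob_M[of x] by simp
    have "(\<lambda>\<omega>. V x \<omega> = M) -` {b} \<inter> space P = (if b then {\<omega> \<in> space P. V x \<omega> = M} else {\<omega> \<in> space P. V x \<omega> \<noteq> M})"
      by auto
    then show "emeasure (distr P (count_space UNIV) (\<lambda>\<omega>. V x \<omega> = M)) {b} = emeasure (measure_pmf (bernoulli_pmf p)) {b}"
      using p by (subst emeasure_distr) (auto simp: emeasure_eq_measure prob_M f emeasure_pmf_single)
  qed auto
  have sets_eq: "sets (bernoulli_env p) = sets (PiM UNIV ?B)"
    unfolding bernoulli_env_def by (intro sets_PiM_cong) auto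
  show "(\<lambda>\<omega> x. V x \<omega> = M) \<in> measurable P (bernoulli_env p)"
    unfolding measurable_cong_sets[OF refl sets_eq] by (rule measurable_PiM_single') auto
  have "distr P (bernoulli_env p) (\<lambda>\<omega> x. V x \<omega> = M) = distr P (PiM UNIV ?B) (\<lambda>\<omega>. \<lambda>x\<in>UNIV. V x \<omega> = M)"
    by (intro distr_cong refl sets_eq) (auto simp: fun_eq_iff)
  also have "\<dots> = PiM UNIV (\<lambda>x. distr P (count_space UNIV) (\<lambda>\<omega>. V x \<omega> = M))"
    using iv by (subst (asm) indep_vars_iff_distr_eq_PiM) auto
  finally show "distr P (bernoulli_env p) (\<lambda>\<omega> x. V x \<omega> = M) = bernoulli_env p"
    unfolding one bernoulli_env_def .
  have "AE \<omega> in P. V x \<omega> = (if V x \<omega> = M then M else 0)" for x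
  proof -
    have "prob ({\<omega> \<in> space P. V x \<omega> = M} \<union> {\<omega> \<in> space P. V x \<omega> = 0}) =
        prob {\<omega> \<in> space P. V x \<omega> = M} + prob {\<omega> \<in> space P. V x \<omega> = 0}"
      using assms by (intro finite_measure_Union) auto
    then have "prob {\<omega> \<in> space P. V x \<omega> = M \<or> V x \<omega> = 0} = 1"
      by (simp add: prob_M prob_0 Un_def conj_disj_distribL[symmetric] Collect_disj_eq[symmetric])
    then have "AE \<omega> in P. V x \<omega> = M \<or> V x \<omega> = 0"
      by (subst (asm) prob_Collect_eq_1) auto
    then show ?thesis by (rule AE_mp) auto
  qed
  then show "AE \<omega> in P. \<forall>x. V x \<omega> = (if V x \<omega> = M then M else 0)"
    by (simp add: AE_all_countable)
qed

text \<open>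
  The condition \<open>p * wall_defect (exp (- M)) < 1\<close> ensures \<open>T < \<infinity>\<close>. Then the limit in the definition
  of the speed exists, and the speed is \<open>1 / T\<close>.
\<close>

lemma (in bernoulli_potential) quenched_speed_bounds:
  assumes p: "0 < p" "p \<le> 1" and M: "0 < M" and small: "p * wall_defect (exp (- M)) < 1"
  shows "(1 - p * wall_defect (exp (- M))) / (mean_lower p + 3 * wall_defect (exp (- M))) \<le> quenched_speed P V"
    and "quenched_speed P V \<le> 1 / mean_lower p"
proof -
  define r where "r = exp (- M)"
  have r: "0 < r" "r < 1" using M by (auto simp: r_def)
  obtain T where T: "(\<lambda>n. bernoulli_mean p n (window_time r)) \<longlonglongrightarrow> T"
    "\<And>n. bernoulli_mean p n (window_time r) \<le> T"
    "mean_lower p \<le> T" "T \<le> (mean_lower p + 3 * wall_defect r) / (1 - p * wall_defect r)"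
    using mean_window_time_tendsto[OF r p] small unfolding r_def by metis
  have L: "1 \<le> mean_lower p" using p by (simp add: mean_lower_eq)
  then have T0: "0 < T" using T(3) by linarith
  have lim: "AE \<omega> in P. (\<lambda>y. quenched_mean_time (\<lambda>x. V x \<omega>) y / of_nat y) \<longlonglongrightarrow> ennreal T"
  proof -
    have "AE b in distr P (bernoulli_env p) (\<lambda>\<omega> x. V x \<omega> = M). \<exists>t.
        (\<forall>x. (\<lambda>m. window_time r (left_window b m x)) \<longlonglongrightarrow> t x) \<and>
        (\<lambda>y. (\<Sum>x<y. t (int x)) / real y) \<longlonglongrightarrow> T"
      using AE_average_passage_time[OF r p T(1,2)] M by (subst distr_obstacles(2)) simp_all
    then have "AE \<omega> in P. \<exists>t.
        (\<forall>x. (\<lambda>m. window_time r (left_window (\<lambda>x. V x \<omega> = M) m x)) \<longlonglongrightarrow> t x) \<and>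
        (\<lambda>y. (\<Sum>x<y. t (int x)) / real y) \<longlonglongrightarrow> T"
      by (rule AE_distrD[rotated]) (use distr_obstacles(1) M in auto)
    with distr_obstacles(3) show ?thesis
    proof (rule AE_mp[OF _ AE_mp])
      show "M \<noteq> 0" using M by simp
      show "AE \<omega> in P. (\<exists>t. (\<forall>x. (\<lambda>m. window_time r (left_window (\<lambda>x. V x \<omega> = M) m x)) \<longlonglongrightarrow> t x) \<and>
          (\<lambda>y. (\<Sum>x<y. t (int x)) / real y) \<longlonglongrightarrow> T) \<longrightarrow>
        (\<forall>x. V x \<omega> = (if V x \<omega> = M then M else 0)) \<longrightarrow>
        (\<lambda>y. quenched_mean_time (\<lambda>x. V x \<omega>) y / of_nat y) \<longlonglongrightarrow> ennreal T"
      proof (intro AE_I2 impI, elim exE conjE)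
        fix \<omega> t
        assume t: "\<forall>x. (\<lambda>m. window_time r (left_window (\<lambda>x. V x \<omega> = M) m x)) \<longlonglongrightarrow> t x"
          and tT: "(\<lambda>y. (\<Sum>x<y. t (int x)) / real y) \<longlonglongrightarrow> T"
          and V: "\<forall>x. V x \<omega> = (if V x \<omega> = M then M else 0)"
        have Vn: "0 \<le> V x \<omega>" for x using V[rule_format, of x] M by (auto split: if_splits)
        have e: "survival r (V x \<omega> = M) = exp (- V x \<omega>)" for x
          using V[rule_format, of x] by (auto simp: r_def split: if_splits)
        have ut: "(\<lambda>m. up_time (left_window (\<lambda>x. exp (- V x \<omega>)) m x)) \<longlonglongrightarrow> t x" for x
          using t[rule_format, of x] unfolding window_time_def map_left_window e .
        have tn: "0 \<le> t x" for x
          by (rule LIMSEQ_le_const[OF t[rule_format, of x]]) (auto intro!: window_time_nonneg[OF r])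
        have "(\<lambda>y. ennreal ((\<Sum>x<y. t (int x)) / real y)) \<longlonglongrightarrow> ennreal T"
          using tT by (rule tendsto_ennrealI)
        moreover have "\<forall>\<^sub>F y in sequentially. ennreal ((\<Sum>x<y. t (int x)) / real y) =
            quenched_mean_time (\<lambda>x. V x \<omega>) y / of_nat y"
          using eventually_gt_at_top[of 0]
        proof eventually_elim
          case (elim y)
          then show ?case
            using quenched_mean_time_eq[where U = "\<lambda>x. V x \<omega>" and y = y and t = t, OF Vn elim ut] tn
            by (simp add: divide_ennreal[symmetric] sum_nonneg ennreal_of_nat_eq_real_of_nat)
        qed
        ultimately show "(\<lambda>y. quenched_mean_time (\<lambda>x. V x \<omega>) y / of_nat y) \<longlonglongrightarrow> ennreal T"
          by (rule Lim_transform_eventually)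
      qed
    qed
  qed
  have "quenched_speed P V = 1 / T"
    unfolding quenched_speed_def
  proof (rule the_equality)
    show "0 < 1 / T \<and> (AE \<omega> in P. (\<lambda>y. quenched_mean_time (\<lambda>x. V x \<omega>) y / of_nat y) \<longlonglongrightarrow> ennreal (1 / (1 / T)))"
      using lim T0 by simp
    fix v assume v: "0 < v \<and> (AE \<omega> in P. (\<lambda>y. quenched_mean_time (\<lambda>x. V x \<omega>) y / of_nat y) \<longlonglongrightarrow> ennreal (1 / v))"
    have "AE \<omega> in P. ennreal (1 / v) = ennreal T"
      by (intro eventually_elim2[OF conjunct2[OF v] lim] LIMSEQ_unique)
    then have "ennreal (1 / v) = ennreal T" by simp
    then have "1 / v = T" using v T0 by simp
    then show "v = 1 / T" by auto
  qed
  moreover have "1 / T \<le> 1 / mean_lower p" using T(3) L by (intro divide_left_mono) auto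
  moreover have "(1 - p * wall_defect r) / (mean_lower p + 3 * wall_defect r) \<le> 1 / T"
  proof -
    have "0 < wall_defect r" using r by (simp add: wall_defect_def)
    then show ?thesis using T(4) T0 L small by (simp add: r_def[symmetric] field_simps)
  qed
  ultimately show "(1 - p * wall_defect (exp (- M))) / (mean_lower p + 3 * wall_defect (exp (- M))) \<le> quenched_speed P V"
    "quenched_speed P V \<le> 1 / mean_lower p"
    by (simp_all add: r_def)
qed

lemma wall_defect_nonneg: "0 \<le> r \<Longrightarrow> r < 1 \<Longrightarrow> 0 \<le> wall_defect r"
  by (simp add: wall_defect_def)

lemma wall_defect_mono: "0 \<le> r \<Longrightarrow> r \<le> s \<Longrightarrow> s < 1 \<Longrightarrow> wall_defect r \<le> wall_defect s"
  unfolding wall_defect_def by (intro frac_le) auto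

lemma wall_defect_exp_tendsto: "((\<lambda>M. wall_defect (exp (- M))) \<longlongrightarrow> 0) at_top"
proof -
  have "((\<lambda>M::real. exp (- M)) \<longlongrightarrow> 0) at_top"
    by (rule filterlim_compose[OF exp_at_bot filterlim_uminus_at_bot_at_top])
  then have "((\<lambda>M::real. exp (- M) / (2 - 2 * exp (- M))) \<longlongrightarrow> 0 / (2 - 2 * 0)) at_top"
    by (intro tendsto_intros) auto
  then show ?thesis by (simp add: wall_defect_def)
qed

theorem theorem1p1:
  fixes P :: "real \<Rightarrow> real \<Rightarrow> 'w measure"
    and V :: "real \<Rightarrow> real \<Rightarrow> int \<Rightarrow> 'w \<Rightarrow> real"
  assumes potential: "\<And>p M. 0 < p \<Longrightarrow> p \<le> 1 \<Longrightarrow> 0 < M \<Longrightarrow>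
      bernoulli_potential (P p M) (V p M) p M"
  shows "(\<forall>M0>0. uniform_limit {M0..}
        (\<lambda>p M. quenched_speed (P p M) (V p M) / (3 * p / 2)) (\<lambda>_. 1) (at_right 0)) \<and>
    (\<forall>K. compact K \<and> K \<subseteq> {0<..1} \<longrightarrow> uniform_limit K
        (\<lambda>M p. quenched_speed (P p M) (V p M) / (3 * p / (2 - p + 2 * p\<^sup>2))) (\<lambda>_. 1) at_top)"
proof -
  let ?v = "\<lambda>p M. quenched_speed (P p M) (V p M)"
  let ?d = "\<lambda>M. wall_defect (exp (- M))"
  have bounds: "(1 - p * ?d M) / (mean_lower p + 3 * ?d M) \<le> ?v p M" "?v p M \<le> 1 / mean_lower p"
    if "0 < p" "p \<le> 1" "0 < M" "p * ?d M < 1" for p M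
    using bernoulli_potential.quenched_speed_bounds[OF potential[OF that(1-3)] that] .
  have d0: "0 \<le> ?d M" if "0 < M" for M using that by (intro wall_defect_nonneg) auto
  have near: "dist u 1 < e" if "l \<le> u" "u \<le> h" "dist l 1 < e" "dist h 1 < e" for l u h e :: real
    using that by (auto simp: dist_real_def)
  have cross: "x / y \<le> u / w * z" if "x * w \<le> u * (z * y)" "0 < y" "0 < w" for x y z u w :: real
    using that by (simp add: field_simps)
  have "uniform_limit {M0..} (\<lambda>p M. ?v p M / (3 * p / 2)) (\<lambda>_. 1) (at_right 0)" if M0: "0 < M0" for M0
  proof (rule uniform_limitI)
    fix e :: real assume e: "0 < e"
    let ?q = "\<lambda>p :: real. 2 - p + 2 * p\<^sup>2"
    \<comment> \<open>The bounds for the speed, divided by \<open>3 * p / 2\<close>, at the worst height \<open>M0\<close>.\<close>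
    let ?l = "\<lambda>p. 2 * (1 - p * ?d M0) / (?q p + 9 * p * ?d M0)"
    have "(?l \<longlongrightarrow> 2 * (1 - 0 * ?d M0) / (2 - 0 + 2 * 0\<^sup>2 + 9 * 0 * ?d M0)) (at_right 0)"
      by (intro tendsto_intros) auto
    then have "\<forall>\<^sub>F p in at_right 0. dist (?l p) 1 < e"
      using e by (intro tendstoD) auto
    moreover have "((\<lambda>p. 2 / ?q p) \<longlongrightarrow> 2 / (2 - 0 + 2 * 0\<^sup>2)) (at_right 0)"
      by (intro tendsto_intros) auto
    then have "\<forall>\<^sub>F p in at_right 0. dist (2 / ?q p) 1 < e"
      using e by (intro tendstoD) auto
    moreover have "((\<lambda>p. p * ?d M0) \<longlongrightarrow> 0 * ?d M0) (at_right 0)" by (intro tendsto_intros)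
    then have "\<forall>\<^sub>F p in at_right 0. p * ?d M0 < 1" by (rule order_tendstoD) simp
    moreover have "\<forall>\<^sub>F p :: real in at_right 0. 0 < p \<and> p < 1"
      using eventually_at_right_real[of 0 1] by (simp add: greaterThanLessThan_iff)
    ultimately show "\<forall>\<^sub>F p in at_right 0. \<forall>M\<in>{M0..}. dist (?v p M / (3 * p / 2)) 1 < e"
    proof eventually_elim
      case (elim p)
      show ?case
      proof
        fix M assume "M \<in> {M0..}"
        then have M: "M0 \<le> M" "0 < M" using M0 by auto
        have p: "0 < p" "p \<le> 1" using elim by auto
        have dM: "?d M \<le> ?d M0" using M M0 by (intro wall_defect_mono) auto
        then have pd: "p * ?d M \<le> p * ?d M0" using p by (intro mult_left_mono) auto
        then have small: "p * ?d M < 1" using elim by linarith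
        have q: "3 * p * mean_lower p = ?q p" using p by (simp add: mean_lower_def)
        have q1: "1 \<le> ?q p"
        proof -
          have "0 \<le> p\<^sup>2" by simp
          then show ?thesis using p by linarith
        qed
        have "?l p \<le> 2 * (1 - p * ?d M) / (?q p + 9 * p * ?d M)"
          using pd small q1 p d0[OF M(2)] by (intro frac_le) (auto intro!: add_pos_nonneg)
        also have "\<dots> = (1 - p * ?d M) / (mean_lower p + 3 * ?d M) / (3 * p / 2)"
          unfolding q[symmetric] using p by (simp add: field_simps)
        also have "\<dots> \<le> ?v p M / (3 * p / 2)"
          using bounds(1)[OF p M(2) small] p by (intro divide_right_mono) auto
        finally have lower: "?l p \<le> ?v p M / (3 * p / 2)" .
        have "?v p M / (3 * p / 2) \<le> 1 / mean_lower p / (3 * p / 2)"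
          using bounds(2)[OF p M(2) small] p by (intro divide_right_mono) auto
        also have "\<dots> = 2 / ?q p" unfolding q[symmetric] using p by simp
        finally show "dist (?v p M / (3 * p / 2)) 1 < e" using near[OF lower] elim by blast
      qed
    qed
  qed
  moreover have "uniform_limit K (\<lambda>M p. ?v p M / (3 * p / (2 - p + 2 * p\<^sup>2))) (\<lambda>_. 1) at_top"
    if K: "K \<subseteq> {0<..1}" for K
  proof (rule uniform_limitI)
    fix e :: real assume e: "0 < e"
    \<comment> \<open>The lower bound times \<open>mean_lower p\<close>, at its worst over \<open>p \<le> 1\<close> and \<open>mean_lower p \<ge> 1\<close>.\<close>
    let ?l = "\<lambda>M. (1 - ?d M) / (1 + 3 * ?d M)"
    have "(?l \<longlongrightarrow> (1 - 0) / (1 + 3 * 0)) at_top"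
      by (intro tendsto_intros wall_defect_exp_tendsto) auto
    then have "\<forall>\<^sub>F M in at_top. dist (?l M) 1 < e"
      using e by (intro tendstoD) auto
    moreover have "\<forall>\<^sub>F M in at_top. ?d M < 1"
      by (rule order_tendstoD[OF wall_defect_exp_tendsto]) simp
    moreover note eventually_gt_at_top[of "0 :: real"]
    ultimately show "\<forall>\<^sub>F M in at_top. \<forall>p\<in>K. dist (?v p M / (3 * p / (2 - p + 2 * p\<^sup>2))) 1 < e"
    proof eventually_elim
      case (elim M)
      show ?case
      proof
        fix p assume "p \<in> K"
        then have p: "0 < p" "p \<le> 1" using K by auto
        define L where "L = mean_lower p"
        have L: "1 \<le> L" using p by (simp add: L_def mean_lower_eq)
        have eq: "?v p M / (3 * p / (2 - p + 2 * p\<^sup>2)) = ?v p M * L" by (simp add: L_def mean_lower_def)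
        have d: "0 \<le> ?d M" "p * ?d M \<le> ?d M" using d0[OF elim(3)] p by (auto intro: mult_left_le_one_le)
        then have small: "p * ?d M < 1" using elim by linarith
        have "?d M * 1 \<le> ?d M * L" using d L by (intro mult_left_mono) auto
        then have "(1 - ?d M) * (L + 3 * ?d M) \<le> (1 - ?d M) * (L * (1 + 3 * ?d M))"
          using elim by (intro mult_left_mono) (auto simp: algebra_simps)
        also have "\<dots> \<le> (1 - p * ?d M) * (L * (1 + 3 * ?d M))"
          using d L by (intro mult_right_mono) auto
        finally have "?l M \<le> (1 - p * ?d M) / (L + 3 * ?d M) * L"
          using d L by (intro cross) auto
        also have "\<dots> \<le> ?v p M * L"
          using bounds(1)[OF p elim(3) small] L unfolding L_def[symmetric] by (intro mult_right_mono) auto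
        finally have lower: "?l M \<le> ?v p M * L" .
        have "?v p M * L \<le> 1 / L * L"
          using bounds(2)[OF p elim(3) small] L unfolding L_def[symmetric] by (intro mult_right_mono) auto
        then have "?v p M * L \<le> 1" using L by simp
        then show "dist (?v p M / (3 * p / (2 - p + 2 * p\<^sup>2))) 1 < e"
          unfolding eq using near[OF lower, of 1 e] elim e by simp
      qed
    qed
  qed
  ultimately show ?thesis by blast
qed

end
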